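(* For every $x\in\,]1/2,1[$, as $n\to\infty$, $$\mathbb{P}\Big(\frac{D_n}{n}\ge x\Big)=\frac{\exp\big(-nI(x)-\{nx\}t_x\big)}{\sigma_x t_x\sqrt{2\pi n}}\,\big[1+o(1)\big],$$ where $t_x$ is the unique real solution of $L'(t_x)=x$ and $\sigma_x^2=L''(t_x)$ (with $\sigma_x>0$).
   Context: For $n\ge1$, $D_n$ is the number of descents of a permutation $\pi_n$ chosen uniformly at random from the symmetric group on $\{1,\dots,n\}$, i.e. $D_n=\#\{k\in\{1,\dots,n-1\}:\pi_n(k)>\pi_n(k+1)\}$ (so $D_1=0$). The function $L:\mathbb{R}\to\mathbb{R}$ is $L(t)=\log\big(\frac{e^t-1}{t}\big)$ for $t\neq0$, extended by continuity with $L(0)=0$ (it is then twice differentiable and strictly convex, and $L'$ is a bijection from $\mathbb{R}$ onto $]0,1[$, so that $t_x$ is well defined). Its Fenchel–Legendre transform is $I(x)=\sup_{t\in\mathbb{R}}\{xt-L(t)\}$. For a positive real number $y$, the notation $\{y\}$ means $\{y\}=\lceil y\rceil-y$ (this is not the usual fractional part). *)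

theory Defs
  imports
    "HOL-Probability.Probability"
    "HOL-Combinatorics.Permutations"
    "HOL-Library.Landau_Symbols"
begin

definition descent_count :: "nat \<Rightarrow> (nat \<Rightarrow> nat) \<Rightarrow> nat" where
  "descent_count n \<pi> = card {k \<in> {1..n - 1}. \<pi> k > \<pi> (k + 1)}"

definition uniform_perm :: "nat \<Rightarrow> (nat \<Rightarrow> nat) pmf" where
  "uniform_perm n = pmf_of_set {\<pi>. \<pi> permutes {1..n}}"

definition L :: "real \<Rightarrow> real" where
  "L t = (if t = 0 then 0 else ln ((exp t - 1) / t))"

text \<open>
  The supremum is taken in the reals, so it is meaningful only where the set is bounded above.
  This includes every \<open>x\<close> in the open interval from 0 to 1.
\<close>
definition rate_function :: "real \<Rightarrow> real" where
  "rate_function x = (SUP t. x * t - L t)"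

definition saddle :: "real \<Rightarrow> real" where
  "saddle x = (THE t. deriv L t = x)"

definition tilted_sd :: "real \<Rightarrow> real" where
  "tilted_sd x = sqrt (deriv (deriv L) (saddle x))"

text \<open>Distance up to the next integer; this is not the usual fractional part \<^const>\<open>frac\<close>.\<close>
definition ceil_gap :: "real \<Rightarrow> real" where
  "ceil_gap y = of_int \<lceil>y\<rceil> - y"

end

theory Submission
  imports
    Defs
    "HOL-Complex_Analysis.Complex_Analysis"
    "HOL-Real_Asymp.Real_Asymp"
begin

text \<open>
  The number of descents has the law of the integer part of a sum \<open>S\<^sub>n\<close> of \<open>n\<close> independent uniform
  variables on \<open>[0, 1]\<close>, so the event in question is \<open>S\<^sub>n \<ge> \<lceil>n x\<rceil>\<close>, and the claim is a sharp
  large deviation estimate of Bahadur and Rao for \<open>S\<^sub>n\<close>. The variables \<open>S\<^sub>n\<close> never appear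
  below. Their tails are represented by the inversion integral over a vertical line,
  \<open>P(S\<^sub>n \<ge> y) = 1 / (2 \<pi>) * \<integral> M(z)^n * exp (- y * z) / z ds\<close>, where \<open>s\<close> runs through the real line,
  \<open>z = t + \<i> * s\<close>, \<open>M(z) = (exp z - 1) / z\<close>, and \<open>t > 0\<close> is arbitrary.
  At integers \<open>y\<close> the right-hand side equals the probability of at least \<open>y\<close> descents,
  because both sides satisfy the same recursion in \<open>n\<close> and agree for \<open>n = 1\<close>
  (\<open>descent_tail_eq_line_integral\<close>). For permutations the recursion counts the ways to insert a
  new largest value (\<open>descent_tail_Suc\<close>). For the integrals it says that the derivative of
  \<open>z * kernel (Suc n) y z\<close> integrates to zero (\<open>line_integral_Suc\<close>). The case \<open>n = 1\<close> reduces to the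
  inverse Laplace transform of \<open>1 / z\<^sup>2\<close>, a residue computation.

  Now let \<open>t\<close> be the saddle point, \<open>L' t = x\<close>. The size of the integrand at \<open>s = 0\<close> gives the exponential
  factor. What remains is an integral of \<open>tilted_char t s ^ n\<close>, where \<open>tilted_char t\<close> is the
  characteristic function of a centred variable with variance \<open>L'' t\<close>. After the substitution
  \<open>s = u / sqrt n\<close> this power converges pointwise to the Gaussian \<open>exp (- L'' t * u\<^sup>2 / 2)\<close>. The bound
  \<open>norm_tilted_char_le\<close>, valid on the whole line, makes it integrable uniformly in \<open>n\<close>, so dominated
  convergence yields the constant (\<open>local_limit\<close>) with no separate treatment of large \<open>s\<close>.
\<close>

section \<open>Descents and insertion of a new maximum\<close>

text \<open>
  The permutation of \<open>{1..Suc n}\<close> whose one-line notation is that of \<open>\<pi>\<close> with the value \<open>Suc n\<close>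
  put at position \<open>j\<close>.
\<close>
definition insert_max :: "nat \<Rightarrow> nat \<Rightarrow> (nat \<Rightarrow> nat) \<Rightarrow> nat \<Rightarrow> nat" where
  "insert_max n j \<pi> i =
     (if i < j then \<pi> i else if i = j then Suc n else if i \<le> Suc n then \<pi> (i - 1) else i)"

definition descents :: "nat \<Rightarrow> (nat \<Rightarrow> nat) \<Rightarrow> nat set" where
  "descents n \<pi> = {k \<in> {1..n - 1}. \<pi> k > \<pi> (k + 1)}"

lemma descent_count_eq_card_descents: "descent_count n \<pi> = card (descents n \<pi>)"
  by (simp add: descent_count_def descents_def)

lemma finite_descents [simp]: "finite (descents n \<pi>)"
  by (simp add: descents_def)

lemma permutes_in_interval:
  assumes "\<pi> permutes {1..n}"
  shows "1 \<le> \<pi> i \<and> \<pi> i \<le> n \<longleftrightarrow> 1 \<le> i \<and> i \<le> n"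
  using permutes_in_image[OF assms, of i] by simp

lemma insert_max_permutes:
  assumes p: "\<pi> permutes {1..n}" and j: "j \<in> {1..Suc n}"
  shows "insert_max n j \<pi> permutes {1..Suc n}"
proof (rule bij_imp_permutes)
  have into: "insert_max n j \<pi> i \<in> {1..Suc n}" if "i \<in> {1..Suc n}" for i
  proof -
    consider "i < j" | "i = j" | "i > j" by linarith
    thus ?thesis
    proof cases
      case 1
      thus ?thesis using permutes_in_interval[OF p, of i] that j by (auto simp: insert_max_def)
    next
      case 2
      thus ?thesis by (auto simp: insert_max_def)
    next
      case 3
      thus ?thesis using permutes_in_interval[OF p, of "i - 1"] that j by (auto simp: insert_max_def)
    qed
  qed
  have small: "insert_max n j \<pi> i \<noteq> Suc n" if "i \<in> {1..Suc n}" "i \<noteq> j" for i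
  proof (cases "i < j")
    case True
    thus ?thesis using permutes_in_interval[OF p, of i] that j by (auto simp: insert_max_def)
  next
    case False
    thus ?thesis using permutes_in_interval[OF p, of "i - 1"] that j by (auto simp: insert_max_def)
  qed
  have inj: "inj_on (insert_max n j \<pi>) {1..Suc n}"
  proof (rule inj_onI)
    fix a b assume a: "a \<in> {1..Suc n}" and b: "b \<in> {1..Suc n}"
      and eq: "insert_max n j \<pi> a = insert_max n j \<pi> b"
    have top: "insert_max n j \<pi> j = Suc n" by (simp add: insert_max_def)
    show "a = b"
    proof (cases "a = j \<or> b = j")
      case True
      thus ?thesis using small[OF a] small[OF b] eq top by metis
    next
      case False
      hence "\<pi> (if a < j then a else a - 1) = \<pi> (if b < j then b else b - 1)"
        using eq a b by (auto simp: insert_max_def split: if_splits)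
      hence "(if a < j then a else a - 1) = (if b < j then b else b - 1)"
        by (rule injD[OF permutes_inj[OF p]])
      thus ?thesis using False a b by (auto split: if_splits)
    qed
  qed
  show "bij_betw (insert_max n j \<pi>) {1..Suc n} {1..Suc n}"
    unfolding bij_betw_def
    using inj endo_inj_surj[OF _ _ inj] into by (simp add: image_subset_iff)
  show "insert_max n j \<pi> i = i" if "i \<notin> {1..Suc n}" for i
    using that j permutes_not_in[OF p, of i] by (auto simp: insert_max_def)
qed

text \<open>
  Surjectivity comes from counting: the map is injective, since the position of the maximum and the
  remaining values can be read off, and both sides have \<open>fact (Suc n)\<close> elements.
\<close>
lemma bij_betw_insert_max:
  "bij_betw (\<lambda>(\<pi>, j). insert_max n j \<pi>)
     ({\<pi>. \<pi> permutes {1..n}} \<times> {1..Suc n}) {\<pi>. \<pi> permutes {1..Suc n}}"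
  unfolding bij_betw_def
proof
  show inj: "inj_on (\<lambda>(\<pi>, j). insert_max n j \<pi>) ({\<pi>. \<pi> permutes {1..n}} \<times> {1..Suc n})"
  proof (rule inj_onI, clarify)
    fix p j q l
    assume p: "p permutes {1..n}" and q: "q permutes {1..n}"
      and j: "j \<in> {1..Suc n}" and l: "l \<in> {1..Suc n}"
      and eq: "insert_max n j p = insert_max n l q"
    have "insert_max n j p j = Suc n" "insert_max n l q l = Suc n"
      by (simp_all add: insert_max_def)
    hence jl: "j = l"
      using injD[OF permutes_inj[OF insert_max_permutes[OF p j]], of j l] eq by simp
    have "p i = q i" for i
    proof (cases "i \<in> {1..n}")
      case True
      show ?thesis
        using fun_cong[OF eq, of "if i < j then i else Suc i"] True jl
        by (auto simp: insert_max_def split: if_splits)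
    next
      case False
      thus ?thesis using permutes_not_in[OF p] permutes_not_in[OF q] by simp
    qed
    thus "p = q \<and> j = l" using jl by auto
  qed
  show "(\<lambda>(\<pi>, j). insert_max n j \<pi>) ` ({\<pi>. \<pi> permutes {1..n}} \<times> {1..Suc n})
      = {\<pi>. \<pi> permutes {1..Suc n}}"
  proof (rule card_subset_eq)
    show "finite {\<pi>. \<pi> permutes {1..Suc n}}" by (rule finite_permutations) simp
    show "(\<lambda>(\<pi>, j). insert_max n j \<pi>) ` ({\<pi>. \<pi> permutes {1..n}} \<times> {1..Suc n})
      \<subseteq> {\<pi>. \<pi> permutes {1..Suc n}}"
      using insert_max_permutes by auto
    show "card ((\<lambda>(\<pi>, j). insert_max n j \<pi>) ` ({\<pi>. \<pi> permutes {1..n}} \<times> {1..Suc n}))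
      = card {\<pi>. \<pi> permutes {1..Suc n}}"
      unfolding card_image[OF inj] card_cartesian_product
      by (subst (1 2) card_permutations[OF refl]) simp_all
  qed
qed

lemma descents_insert_max:
  assumes p: "\<pi> permutes {1..n}" and j: "j \<in> {1..Suc n}"
  shows "descents (Suc n) (insert_max n j \<pi>) =
    {k \<in> descents n \<pi>. Suc k < j} \<union> {k. k = j \<and> j \<le> n} \<union> Suc ` {k \<in> descents n \<pi>. j \<le> k}"
    (is "?L = ?A \<union> ?B \<union> ?C")
proof (intro equalityI subsetI)
  have le: "\<pi> i \<le> n" if "i \<in> {1..n}" for i
    using permutes_in_interval[OF p, of i] that by auto
  fix k assume "k \<in> ?L"
  hence k: "1 \<le> k" "k \<le> n" and gt: "insert_max n j \<pi> k > insert_max n j \<pi> (Suc k)"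
    by (auto simp: descents_def)
  consider "Suc k < j" | "Suc k = j" | "k = j" | "j < k" by linarith
  thus "k \<in> ?A \<union> ?B \<union> ?C"
  proof cases
    case 1 thus ?thesis using k gt j by (auto simp: descents_def insert_max_def)
  next
    case 2 thus ?thesis using k gt le[of k] by (auto simp: insert_max_def)
  next
    case 3 thus ?thesis using k by auto
  next
    case 4
    hence "k - 1 \<in> descents n \<pi>" "j \<le> k - 1" "k = Suc (k - 1)"
      using k gt j by (auto simp: descents_def insert_max_def)
    thus ?thesis by blast
  qed
next
  have le: "\<pi> i \<le> n" if "i \<in> {1..n}" for i
    using permutes_in_interval[OF p, of i] that by auto
  fix k assume "k \<in> ?A \<union> ?B \<union> ?C"
  thus "k \<in> ?L" using j le[of j]
    by (auto simp: descents_def insert_max_def)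
qed

text \<open>
  The new maximum at position \<open>j\<close> is followed by a descent unless it comes last, and it destroys
  the descent at \<open>j - 1\<close> if there was one. So exactly the last position and the positions inside a
  descent leave the number of descents unchanged.
\<close>
lemma descent_count_insert_max:
  assumes p: "\<pi> permutes {1..n}" and j: "j \<in> {1..Suc n}"
  shows "descent_count (Suc n) (insert_max n j \<pi>) =
    descent_count n \<pi> + (if j \<in> insert (Suc n) (Suc ` descents n \<pi>) then 0 else 1)"
proof -
  let ?D = "descents n \<pi>"
  have "card (descents (Suc n) (insert_max n j \<pi>)) =
      card {k \<in> ?D. Suc k < j} + card {k. k = j \<and> j \<le> n} + card (Suc ` {k \<in> ?D. j \<le> k})"
    unfolding descents_insert_max[OF assms]
    by (subst card_Un_disjoint; (subst card_Un_disjoint)?) auto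
  also have "card (Suc ` {k \<in> ?D. j \<le> k}) = card {k \<in> ?D. j \<le> k}"
    by (rule card_image) simp
  finally have 1: "card (descents (Suc n) (insert_max n j \<pi>)) =
      card {k \<in> ?D. Suc k < j} + card {k. k = j \<and> j \<le> n} + card {k \<in> ?D. j \<le> k}" .
  have "?D = {k \<in> ?D. Suc k < j} \<union> {k \<in> ?D. Suc k = j} \<union> {k \<in> ?D. j \<le> k}" by auto
  hence "card ?D = card ({k \<in> ?D. Suc k < j} \<union> {k \<in> ?D. Suc k = j} \<union> {k \<in> ?D. j \<le> k})" by simp
  also have "\<dots> = card {k \<in> ?D. Suc k < j} + card {k \<in> ?D. Suc k = j} + card {k \<in> ?D. j \<le> k}"
    by (subst card_Un_disjoint; (subst card_Un_disjoint)?) auto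
  finally have 2: "card ?D = \<dots>" .
  have 3: "{k \<in> ?D. Suc k = j} = (if j \<in> Suc ` ?D then {j - 1} else {})" using j by auto
  have 4: "{k. k = j \<and> j \<le> n} = (if j = Suc n then {} else {j})" using j by auto
  have 5: "Suc n \<notin> Suc ` ?D" by (auto simp: descents_def)
  show ?thesis using 1 2 5 unfolding 3 4 descent_count_eq_card_descents by auto
qed

text \<open>
  The threshold is an integer rather than a natural number so that the recursion below, which shifts it
  down by one, holds without a boundary case.
\<close>
definition descent_tail :: "nat \<Rightarrow> int \<Rightarrow> nat" where
  "descent_tail n k = card {\<pi>. \<pi> permutes {1..n} \<and> k \<le> int (descent_count n \<pi>)}"

text \<open>
  A permutation with \<open>d\<close> descents has \<open>d + 1\<close> insertions that keep \<open>d\<close> and \<open>n - d\<close> that raise it to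
  \<open>d + 1\<close>. The sum of two truth values puts the cases \<open>k \<le> d\<close>, \<open>k = d + 1\<close> and \<open>k > d + 1\<close> into one formula
  that is linear in the indicators, so that it can be summed over all permutations.
\<close>
lemma card_insertions:
  assumes p: "\<pi> permutes {1..n}" and n: "n \<ge> 1"
  shows "real (card {j \<in> {1..Suc n}. k \<le> int (descent_count (Suc n) (insert_max n j \<pi>))}) =
    of_int k * of_bool (k \<le> int (descent_count n \<pi>)) +
    (real (Suc n) - of_int k) * of_bool (k - 1 \<le> int (descent_count n \<pi>))"
proof -
  let ?D = "descents n \<pi>" and ?d = "descent_count n \<pi>"
  let ?S = "insert (Suc n) (Suc ` ?D)"
  have S: "?S \<subseteq> {1..Suc n}" using n by (auto simp: descents_def)
  have "Suc n \<notin> Suc ` ?D" by (auto simp: descents_def)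
  hence cS: "card ?S = Suc ?d"
    by (simp add: card_image descent_count_eq_card_descents)
  have eq: "{j \<in> {1..Suc n}. k \<le> int (descent_count (Suc n) (insert_max n j \<pi>))} =
     {j \<in> {1..Suc n}. k \<le> int ?d + (if j \<in> ?S then 0 else 1)}"
    using descent_count_insert_max[OF p] by auto
  consider "k \<le> int ?d" | "k = int ?d + 1" | "k > int ?d + 1" by linarith
  thus ?thesis
  proof cases
    case 1
    hence "{j \<in> {1..Suc n}. k \<le> int ?d + (if j \<in> ?S then 0 else 1)} = {1..Suc n}" by auto
    thus ?thesis using 1 unfolding eq by simp
  next
    case 2
    hence "{j \<in> {1..Suc n}. k \<le> int ?d + (if j \<in> ?S then 0 else 1)} = {1..Suc n} - ?S" by auto
    moreover have "card ({1..Suc n} - ?S) = Suc n - Suc ?d"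
      using S cS by (subst card_Diff_subset) (auto intro: finite_subset)
    moreover have "Suc ?d \<le> Suc n"
      using card_mono[OF _ S] cS by simp
    ultimately show ?thesis using 2 unfolding eq by (simp add: of_nat_diff)
  next
    case 3
    hence "{j \<in> {1..Suc n}. k \<le> int ?d + (if j \<in> ?S then 0 else 1)} = {}" by auto
    thus ?thesis using 3 unfolding eq by simp
  qed
qed

text \<open>
  This is the Eulerian recursion, summed over the upper tail.
\<close>
lemma descent_tail_Suc:
  assumes n: "n \<ge> 1"
  shows "real (descent_tail (Suc n) k) =
    of_int k * real (descent_tail n k) +
    (real (Suc n) - of_int k) * real (descent_tail n (k - 1))"
proof -
  let ?P = "{\<pi>. \<pi> permutes {1..n}}"
  let ?f = "\<lambda>(\<pi>, j). insert_max n j \<pi>"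
  let ?J = "\<lambda>\<pi>. {j \<in> {1..Suc n}. k \<le> int (descent_count (Suc n) (insert_max n j \<pi>))}"
  have fin: "finite ?P" by (rule finite_permutations) simp
  have tail: "real (descent_tail n m) = (\<Sum>\<pi>\<in>?P. of_bool (m \<le> int (descent_count n \<pi>)))" for m
    using fin by (simp add: descent_tail_def Int_def sum.If_cases flip: of_bool_def)
  have "bij_betw ?f (SIGMA \<pi>:?P. ?J \<pi>)
      {\<pi>. \<pi> permutes {1..Suc n} \<and> k \<le> int (descent_count (Suc n) \<pi>)}"
  proof (rule bij_betw_subset[OF bij_betw_insert_max])
    have img: "?f ` (?P \<times> {1..Suc n}) = {\<pi>. \<pi> permutes {1..Suc n}}"
      using bij_betw_insert_max by (rule bij_betw_imp_surj_on)
    show "?f ` (SIGMA \<pi>:?P. ?J \<pi>) = {\<pi>. \<pi> permutes {1..Suc n} \<and> k \<le> int (descent_count (Suc n) \<pi>)}"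
    proof (intro equalityI subsetI)
      fix q assume "q \<in> {\<pi>. \<pi> permutes {1..Suc n} \<and> k \<le> int (descent_count (Suc n) \<pi>)}"
      moreover from this obtain z where "z \<in> ?P \<times> {1..Suc n}" "q = ?f z" using img by blast
      ultimately show "q \<in> ?f ` (SIGMA \<pi>:?P. ?J \<pi>)" by (auto intro!: image_eqI[of _ _ z])
    qed (use insert_max_permutes in auto)
  qed auto
  hence "descent_tail (Suc n) k = card (SIGMA \<pi>:?P. ?J \<pi>)"
    unfolding descent_tail_def by (rule bij_betw_same_card[symmetric])
  also have "\<dots> = (\<Sum>\<pi>\<in>?P. card (?J \<pi>))" using fin by (subst card_SigmaI) auto
  finally have "real (descent_tail (Suc n) k) = (\<Sum>\<pi>\<in>?P. real (card (?J \<pi>)))" by simp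
  also have "\<dots> = (\<Sum>\<pi>\<in>?P. of_int k * of_bool (k \<le> int (descent_count n \<pi>)) +
    (real (Suc n) - of_int k) * of_bool (k - 1 \<le> int (descent_count n \<pi>)))"
    using n by (intro sum.cong refl card_insertions) auto
  also have "\<dots> = of_int k * real (descent_tail n k) +
    (real (Suc n) - of_int k) * real (descent_tail n (k - 1))"
    unfolding tail by (simp only: sum.distrib sum_distrib_left)
  finally show ?thesis .
qed

lemma descent_tail_1: "descent_tail 1 k = of_bool (k \<le> 0)"
proof -
  have "{\<pi>. \<pi> permutes {1..1::nat} \<and> k \<le> int (descent_count 1 \<pi>)} = (if k \<le> 0 then {id} else {})"
    by (auto simp: descent_count_def)
  thus ?thesis by (simp add: descent_tail_def)
qed

lemma prob_descent_count_ge: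
  "measure_pmf.prob (uniform_perm n) {\<pi>. k \<le> int (descent_count n \<pi>)} =
     real (descent_tail n k) / fact n"
proof -
  let ?P = "{\<pi>. \<pi> permutes {1..n}}"
  have fin: "finite ?P" by (rule finite_permutations) simp
  have ne: "?P \<noteq> {}" using permutes_id by blast
  have "card ?P = fact n" by (subst card_permutations[OF refl]) simp_all
  moreover have "?P \<inter> {\<pi>. k \<le> int (descent_count n \<pi>)} = {\<pi>. \<pi> permutes {1..n} \<and> k \<le> int (descent_count n \<pi>)}"
    by auto
  ultimately show ?thesis
    unfolding uniform_perm_def measure_pmf_of_set[OF ne fin] descent_tail_def by simp
qed

section \<open>The cumulant generating function and its saddle point\<close>

text \<open>
  The derivative of \<^const>\<open>L\<close>; the value at \<open>0\<close> is the mean of a uniform variable.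
\<close>
definition L' :: "real \<Rightarrow> real" where
  "L' t = (if t = 0 then 1 / 2 else exp t / (exp t - 1) - 1 / t)"

text \<open>
  The derivative of \<open>L'\<close> away from \<open>0\<close>: the variance of a uniform variable under exponential tilting.
\<close>
definition L'' :: "real \<Rightarrow> real" where
  "L'' t = 1 / t\<^sup>2 - exp t / (exp t - 1)\<^sup>2"

lemma expm1_div_pos: "(exp t - 1) / t > 0" if "t \<noteq> 0" for t :: real
proof (cases "t > 0")
  case True
  thus ?thesis by simp
next
  case False
  thus ?thesis using that by (intro divide_neg_neg) auto
qed

lemma DERIV_L: "(L has_real_derivative L' t) (at t)"
proof (cases "t = 0")
  case True
  have "((\<lambda>h. ln ((exp h - 1) / h) / h) \<longlongrightarrow> 1 / 2) (at_left (0::real))"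
    and "((\<lambda>h. ln ((exp h - 1) / h) / h) \<longlongrightarrow> 1 / 2) (at_right (0::real))"
    by real_asymp+
  hence "((\<lambda>h. ln ((exp h - 1) / h) / h) \<longlongrightarrow> 1 / 2) (at (0::real))"
    by (simp add: filterlim_split_at)
  hence "((\<lambda>h. (L (0 + h) - L 0) / h) \<longlongrightarrow> 1 / 2) (at 0)"
    by (rule Lim_transform_eventually) (auto simp: L_def eventually_at intro!: exI[of _ 1])
  thus ?thesis unfolding True by (simp add: DERIV_def L'_def)
next
  case False
  have ne: "exp t - 1 \<noteq> 0" using False by simp
  have "((\<lambda>t. ln ((exp t - 1) / t)) has_real_derivative L' t) (at t)"
    using False expm1_div_pos[OF False] ne
    by (auto intro!: derivative_eq_intros simp: L'_def divide_simps)
  moreover have "eventually (\<lambda>s. ln ((exp s - 1) / s) = L s) (nhds t)"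
    using t1_space_nhds[OF False] by eventually_elim (auto simp: L_def)
  ultimately show ?thesis
    by (subst (asm) DERIV_cong_ev[OF refl _ refl]) auto
qed

lemma deriv_L: "deriv L = L'"
  using DERIV_L by (auto intro!: ext DERIV_imp_deriv)

lemma DERIV_L': "(L' has_real_derivative L'' t) (at t)" if t: "t \<noteq> 0"
proof -
  have ne: "exp t - 1 \<noteq> 0" using t by simp
  have "((\<lambda>t. exp t / (exp t - 1) - 1 / t) has_real_derivative L'' t) (at t)"
    using t ne
    by (auto intro!: derivative_eq_intros simp: L''_def) (simp add: divide_simps power2_eq_square algebra_simps)
  moreover have "eventually (\<lambda>s. exp s / (exp s - 1) - 1 / s = L' s) (nhds t)"
    using t1_space_nhds[OF t] by eventually_elim (auto simp: L'_def)
  ultimately show ?thesis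
    by (subst (asm) DERIV_cong_ev[OF refl _ refl]) auto
qed

text \<open>
  Multiplied by \<open>t\<^sup>2 * (exp t - 1)\<^sup>2\<close> and rewritten with \<open>exp t - 1 = 2 * exp (t / 2) * sinh (t / 2)\<close>, the claim is
  \<open>t / 2 < sinh (t / 2)\<close>.
\<close>
lemma L''_pos: "L'' t > 0" if t: "t > 0"
proof -
  have "(exp t - 1)\<^sup>2 = exp t * (2 * sinh (t / 2))\<^sup>2"
  proof -
    have "exp t - 1 = exp (t / 2) * (2 * sinh (t / 2))"
      by (simp add: sinh_def algebra_simps flip: exp_add exp_minus)
    moreover have "(exp (t / 2))\<^sup>2 = exp t" by (simp flip: exp_double)
    ultimately show ?thesis by (simp add: power_mult_distrib)
  qed
  moreover have "sinh 0 - 0 < sinh (t / 2) - t / 2"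
  proof (rule DERIV_pos_imp_increasing_open[where f = "\<lambda>s. sinh s - s"])
    fix s :: real assume "0 < s"
    hence "cosh s - 1 > 0" using cosh_real_strict_mono[of 0 s] by simp
    moreover have "((\<lambda>s. sinh s - s) has_real_derivative (cosh s - 1)) (at s)"
      by (auto intro!: derivative_eq_intros)
    ultimately show "\<exists>y. ((\<lambda>s. sinh s - s) has_real_derivative y) (at s) \<and> y > 0" by blast
  qed (use t in \<open>auto intro!: continuous_intros\<close>)
  hence "t\<^sup>2 < (2 * sinh (t / 2))\<^sup>2"
    using t by (intro power_strict_mono) auto
  ultimately have "exp t * t\<^sup>2 < (exp t - 1)\<^sup>2" by simp
  thus ?thesis using t by (simp add: L''_def divide_simps mult.commute)
qed

text \<open>
  If \<open>U\<close> is uniform then so is \<open>1 - U\<close>. This reduces negative arguments to positive ones.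
\<close>
lemma L'_reflect: "L' (- t) = 1 - L' t"
proof (cases "t = 0")
  case False
  hence "exp t - 1 \<noteq> 0" "exp (-t) - 1 \<noteq> 0" by auto
  have "exp (- t) / (exp (- t) - 1) = - 1 / (exp t - 1)" 
    using \<open>exp t - 1 \<noteq> 0\<close> \<open>exp (-t) - 1 \<noteq> 0\<close>  by (simp add: divide_simps exp_minus) 
  moreover have "exp t / (exp t - 1) = 1 + 1 / (exp t - 1)"
    using \<open>exp t - 1 \<noteq> 0\<close> by (simp add: divide_simps)
  ultimately show ?thesis using False by (simp add: L'_def)
qed (simp add: L'_def)

lemma L'_strict_mono: "L' s < L' t" if "0 < s" "s < t"
  using that DERIV_L' L''_pos by (intro DERIV_pos_imp_increasing[of s t L']) (metis less_le_trans less_imp_neq)+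

lemma L'_at_right_0: "(L' \<longlongrightarrow> 1 / 2) (at_right 0)"
proof (rule Lim_transform_eventually)
  show "((\<lambda>t. exp t / (exp t - 1) - 1 / t) \<longlongrightarrow> 1 / 2) (at_right (0::real))" by real_asymp
  show "eventually (\<lambda>t. exp t / (exp t - 1) - 1 / t = L' t) (at_right 0)"
    by (auto simp: eventually_at_filter L'_def)
qed

lemma L'_at_top: "(L' \<longlongrightarrow> 1) at_top"
proof (rule Lim_transform_eventually)
  show "((\<lambda>t. exp t / (exp t - 1) - 1 / t) \<longlongrightarrow> 1) (at_top :: real filter)" by real_asymp
  show "eventually (\<lambda>t. exp t / (exp t - 1) - 1 / t = L' t) at_top"
    using eventually_gt_at_top[of 0] by eventually_elim (auto simp: L'_def)
qed

lemma L'_gt_half: "L' t > 1 / 2" if t: "t > 0"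
proof -
  have "L' (t / 2) \<ge> 1 / 2"
  proof (rule tendsto_upperbound[OF L'_at_right_0])
    show "eventually (\<lambda>s. L' s \<le> L' (t / 2)) (at_right 0)"
      using eventually_at_right_real[of 0 "t / 2"] t
      by (auto elim!: eventually_mono intro: less_imp_le[OF L'_strict_mono])
  qed simp
  also have "L' (t / 2) < L' t" using t by (intro L'_strict_mono) auto
  finally show ?thesis .
qed

lemma L'_le_half: "L' t \<le> 1 / 2" if "t \<le> 0"
  using L'_gt_half[of "-t"] L'_reflect[of t] that by (cases "t = 0") (auto simp: L'_def[of 0])

text \<open>
  On the positive axis \<open>L'\<close> increases strictly from \<open>1 / 2\<close> to \<open>1\<close>, and elsewhere it is at most \<open>1 / 2\<close>,
  so the description of \<^const>\<open>saddle\<close> has exactly one solution.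
\<close>
lemma saddle_props:
  assumes x: "1 / 2 < x" "x < 1"
  shows saddle_pos: "saddle x > 0" and L'_saddle: "L' (saddle x) = x"
proof -
  obtain a where a: "a > 0" "L' a < x"
  proof -
    have "eventually (\<lambda>t. L' t < x) (at_right 0)"
      using L'_at_right_0 x(1) by (rule order_tendstoD)
    hence "eventually (\<lambda>t. L' t < x \<and> t > 0) (at_right 0)"
      by (intro eventually_conj eventually_at_right_less)
    thus ?thesis using that eventually_happens'[OF trivial_limit_at_right_real] by blast
  qed
  obtain b where b: "b > a" "L' b > x"
  proof -
    have "eventually (\<lambda>t. L' t > x) at_top"
      using L'_at_top x(2) by (rule order_tendstoD)
    hence "eventually (\<lambda>t. L' t > x \<and> t > a) at_top"
      by (intro eventually_conj eventually_gt_at_top)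
    thus ?thesis using that eventually_happens'[OF trivial_limit_at_top_linorder] by blast
  qed
  have "\<exists>t. a \<le> t \<and> t \<le> b \<and> L' t = x"
    using a b by (intro IVT[of L']) (auto intro!: DERIV_isCont[OF DERIV_L'])
  then obtain t where "a \<le> t" and t: "L' t = x" by blast
  with a(1) have t: "t > 0" "L' t = x" by auto
  have "saddle x = t"
    unfolding saddle_def deriv_L
  proof (rule the_equality)
    fix s assume "L' s = x"
    hence "s > 0" using L'_le_half[of s] x by force
    thus "s = t" using L'_strict_mono[of s t] L'_strict_mono[of t s] t \<open>L' s = x\<close>
      by (cases s t rule: linorder_cases) auto
  qed fact
  thus "saddle x > 0" "L' (saddle x) = x" using t by auto
qed

text \<open>
  The saddle point maximises \<open>x * s - L s\<close>: by the mean value theorem the difference to the value at any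
  other \<open>s\<close> is governed by \<open>L'\<close> at an intermediate point, and \<open>L'\<close> is below \<open>x\<close> to the left of the saddle
  point and above \<open>x\<close> to its right.
\<close>
lemma rate_function_eq:
  assumes x: "1 / 2 < x" "x < 1"
  shows "rate_function x = x * saddle x - L (saddle x)"
proof -
  define t where "t = saddle x"
  have t: "t > 0" "L' t = x" using saddle_props[OF x] by (simp_all add: t_def)
  have "x * s - L s \<le> x * t - L t" for s
  proof (cases s t rule: linorder_cases)
    case less
    then obtain u where u: "s < u" "u < t" "L t - L s = (t - s) * L' u"
      using MVT2[of s t L L'] DERIV_L by auto
    have "L' u \<le> x"
      using L'_le_half[of u] x L'_strict_mono[of u t] t u by (cases "u \<le> 0") auto
    hence "L t - L s \<le> (t - s) * x" unfolding u(3) using less by (intro mult_left_mono) auto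
    thus ?thesis by (simp add: algebra_simps)
  next
    case greater
    then obtain u where u: "t < u" "u < s" "L s - L t = (s - t) * L' u"
      using MVT2[of t s L L'] DERIV_L by auto
    have "x \<le> L' u" using L'_strict_mono[of t u] t u by auto
    hence "L s - L t \<ge> (s - t) * x" unfolding u(3) using greater by (intro mult_left_mono) auto
    thus ?thesis by (simp add: algebra_simps)
  qed simp
  hence "(SUP s. x * s - L s) = x * t - L t"
    by (intro cSup_eq_maximum) auto
  thus ?thesis by (simp add: rate_function_def t_def)
qed

lemma tilted_sd_eq:
  assumes x: "1 / 2 < x" "x < 1"
  shows "tilted_sd x = sqrt (L'' (saddle x))"
  using DERIV_imp_deriv[OF DERIV_L'] saddle_pos[OF x] by (simp add: tilted_sd_def deriv_L)

section \<open>Integrals along a vertical line\<close>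

lemma integrable_inverse_quadratic:
  fixes a b :: real
  assumes "a > 0" "b > 0"
  shows "integrable lborel (\<lambda>s. 1 / (a + b * s\<^sup>2))"
proof -
  have "integrable lborel (\<lambda>x::real. inverse (1 + x\<^sup>2))"
    using integrable_inverse_1_plus_square by (simp add: set_integrable_def)
  hence "integrable lborel (\<lambda>s. inverse (1 + (0 + sqrt (b / a) * s)\<^sup>2))"
    using assms by (intro lborel_integrable_real_affine) auto
  hence "integrable lborel (\<lambda>s. 1 / a * inverse (1 + (0 + sqrt (b / a) * s)\<^sup>2))"
    by (rule integrable_mult_right)
  also have "(\<lambda>s. 1 / a * inverse (1 + (0 + sqrt (b / a) * s)\<^sup>2)) = (\<lambda>s. 1 / (a + b * s\<^sup>2))"
    using assms by (intro ext) (simp add: power_mult_distrib field_simps)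
  finally show ?thesis .
qed

lemma continuous_on_vertical [continuous_intros]:
  "continuous_on A f \<Longrightarrow> continuous_on A (\<lambda>s. Complex t (f s))"
  unfolding Complex_eq by (intro continuous_intros)

lemma Complex_neq_0: "t > 0 \<Longrightarrow> Complex t s \<noteq> 0"
  by (simp add: complex_eq_iff)

lemma norm_vertical_ge: "t > 0 \<Longrightarrow> t \<le> cmod (Complex t s)"
  using abs_Re_le_cmod[of "Complex t s"] by simp

text \<open>
  On the line \<open>Re z = t\<close> one has \<open>cmod z \<ge> t\<close>, so the quotient decays at least like \<open>1 / (t\<^sup>2 + s\<^sup>2)\<close>.
\<close>
lemma integrable_vertical:
  fixes f :: "real \<Rightarrow> complex"
  assumes t: "t > 0" and cont: "continuous_on UNIV f" and bd: "\<And>s. cmod (f s) \<le> B" and p: "p \<ge> 2"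
  shows "integrable lborel (\<lambda>s. f s / Complex t s ^ p)"
proof (rule Bochner_Integration.integrable_bound)
  show "integrable lborel (\<lambda>s. B / t ^ (p - 2) * (1 / (t\<^sup>2 + 1 * s\<^sup>2)))"
    using t by (intro integrable_mult_right integrable_inverse_quadratic) auto
  have "continuous_on UNIV (\<lambda>s. f s / Complex t s ^ p)"
    using Complex_neq_0[OF t] by (intro continuous_intros cont) auto
  thus "(\<lambda>s. f s / Complex t s ^ p) \<in> borel_measurable lborel"
    using borel_measurable_continuous_onI by auto
  show "AE s in lborel. cmod (f s / Complex t s ^ p) \<le> norm (B / t ^ (p - 2) * (1 / (t\<^sup>2 + 1 * s\<^sup>2)))"
  proof (rule AE_I2)
    fix s
    have B: "0 \<le> B" using bd[of 0] norm_ge_zero order_trans by blast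
    have "t ^ (p - 2) * (t\<^sup>2 + s\<^sup>2) \<le> cmod (Complex t s) ^ (p - 2) * (t\<^sup>2 + s\<^sup>2)"
      using norm_vertical_ge[OF t] t by (intro mult_right_mono power_mono) auto
    also have "\<dots> = cmod (Complex t s) ^ (p - 2) * cmod (Complex t s) ^ 2"
      by (simp add: cmod_power2)
    also have "\<dots> = cmod (Complex t s) ^ p"
      using p by (simp only: power_add[symmetric] le_add_diff_inverse2)
    finally have "cmod (f s) / cmod (Complex t s) ^ p \<le> B / (t ^ (p - 2) * (t\<^sup>2 + s\<^sup>2))"
      using t B by (intro frac_le bd) (auto intro!: mult_pos_pos add_pos_nonneg)
    thus "cmod (f s / Complex t s ^ p) \<le> norm (B / t ^ (p - 2) * (1 / (t\<^sup>2 + 1 * s\<^sup>2)))"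
      using B t by (simp add: norm_divide norm_power)
  qed
qed

lemma integral_derivative_vanishing:
  fixes F f :: "real \<Rightarrow> complex"
  assumes der: "\<And>x. (F has_vector_derivative f x) (at x)"
    and cont: "continuous_on UNIV f" and int: "integrable lborel f"
    and lim: "(F \<longlongrightarrow> 0) at_top" "(F \<longlongrightarrow> 0) at_bot"
  shows "(\<integral>x. f x \<partial>lborel) = 0"
proof -
  have "(LBINT x=-\<infinity>..\<infinity>. f x) = 0 - 0"
  proof (rule interval_integral_FTC_integrable)
    show "isCont f x" for x using cont by (simp add: continuous_on_eq_continuous_at)
    show "set_integrable lborel (einterval (-\<infinity>) \<infinity>) f"
      using int by (simp add: set_integrable_def)
  qed (use der lim in \<open>auto simp: ereal_tendsto_simps\<close>)
  thus ?thesis by (simp add: interval_lebesgue_integral_def set_lebesgue_integral_def)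
qed

text \<open>
  With \<open>M z = (exp z - 1) / z\<close>, the moment generating function of a uniform variable, this is
  \<open>M z ^ n * exp (- y * z) / z\<close>. Its integral along a line \<open>Re z = t\<close> with \<open>t > 0\<close> is, for \<open>n \<ge> 1\<close>, \<open>2 * pi\<close> times the
  probability that a sum of \<open>n\<close> independent uniform variables is at least \<open>y\<close>.
\<close>
definition kernel :: "nat \<Rightarrow> real \<Rightarrow> complex \<Rightarrow> complex" where
  "kernel n y z = (exp z - 1) ^ n * exp (- (of_real y * z)) / z ^ Suc n"

definition line_integral :: "real \<Rightarrow> nat \<Rightarrow> real \<Rightarrow> complex" where
  "line_integral t n y = (\<integral>s. kernel n y (Complex t s) \<partial>lborel)"

lemma norm_numerator_le:
  "cmod ((exp (Complex t s) - 1) ^ n * exp (- (of_real y * Complex t s)))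
     \<le> (exp t + 1) ^ n * exp (- (y * t))"
proof -
  have "cmod (exp (Complex t s) - 1) \<le> exp t + 1"
    using norm_triangle_ineq4[of "exp (Complex t s)" 1] by (simp add: norm_exp_eq_Re)
  thus ?thesis
    by (simp add: norm_mult norm_power norm_exp_eq_Re power_mono)
qed

lemma continuous_on_numerator:
  "continuous_on A (\<lambda>s. (exp (Complex t s) - 1) ^ n * exp (- (of_real y * Complex t s)))"
  by (intro continuous_intros)

lemma integrable_kernel:
  assumes "t > 0" "n \<ge> 1"
  shows "integrable lborel (\<lambda>s. kernel n y (Complex t s))"
  unfolding kernel_def using assms
  by (intro integrable_vertical[OF _ continuous_on_numerator norm_numerator_le]) auto

lemma continuous_on_kernel:
  assumes "t > 0"
  shows "continuous_on A (\<lambda>s. kernel n y (Complex t s))"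
  unfolding kernel_def using Complex_neq_0[OF assms]
  by (intro continuous_intros) auto

text \<open>
  The factor \<open>z\<close> turns the kernel of index \<open>Suc n\<close> into \<open>((exp z - 1) / z) ^ Suc n * exp (- y * z)\<close>.
  Each term of its derivative is again a combination of kernels, because
  \<open>(exp z - 1) * exp (- y * z) = exp (- (y - 1) * z) - exp (- y * z)\<close>.
\<close>
lemma DERIV_kernel_primitive:
  assumes "z \<noteq> 0"
  shows "((\<lambda>z. z * kernel (Suc n) y z) has_field_derivative
     of_nat (Suc n) * kernel n (y - 1) z - of_real y * (kernel n (y - 1) z - kernel n y z)
       - of_nat (Suc n) * kernel (Suc n) y z) (at z)"
proof -
  define e where "e = exp (- (of_real y * z))"
  define E where "E = exp z"
  define w where "w = (E - 1) ^ n"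
  define v where "v = z ^ n"
  have e1: "exp (- (of_real (y - 1) * z)) = E * e"
    by (simp add: e_def E_def algebra_simps flip: exp_add)
  have v: "v \<noteq> 0" using assms by (simp add: v_def)
  have "((\<lambda>z. (exp z - 1) ^ Suc n * exp (- (of_real y * z)) / z ^ Suc n) has_field_derivative
     of_nat (Suc n) * kernel n (y - 1) z - of_real y * (kernel n (y - 1) z - kernel n y z)
       - of_nat (Suc n) * kernel (Suc n) y z) (at z)"
    apply (rule derivative_eq_intros refl | use assms in force)+
    unfolding kernel_def e1
    apply (simp add: e_def[symmetric] E_def[symmetric] w_def[symmetric] v_def[symmetric])
    using assms v apply (simp add: divide_simps)
    apply (simp add: algebra_simps)
    done
  moreover have "(\<lambda>z. z * kernel (Suc n) y z) = (\<lambda>z. (exp z - 1) ^ Suc n * exp (- (of_real y * z)) / z ^ Suc n)"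
    by (auto simp: kernel_def fun_eq_iff)
  ultimately show ?thesis by simp
qed

lemma tendsto_inverse_vertical:
  "((\<lambda>s. inverse (Complex t s)) \<longlongrightarrow> 0) at_top" "((\<lambda>s. inverse (Complex t s)) \<longlongrightarrow> 0) at_bot"
proof -
  have le: "\<bar>s\<bar> \<le> cmod (Complex t s)" for s using abs_Im_le_cmod[of "Complex t s"] by simp
  have "filterlim (\<lambda>s::real. \<bar>s\<bar>) at_top at_top" "filterlim (\<lambda>s::real. \<bar>s\<bar>) at_top at_bot"
    using filterlim_at_infinity_imp_norm_at_top[OF at_top_le_at_infinity[THEN filterlim_mono[OF filterlim_ident order_refl]]]
    by (auto simp: filterlim_abs_real intro: filterlim_at_bot_mirror[THEN iffD2])
  hence "filterlim (\<lambda>s. Complex t s) at_infinity at_top" "filterlim (\<lambda>s. Complex t s) at_infinity at_bot"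
    using le by (auto intro!: filterlim_norm_at_top_imp_at_infinity intro: filterlim_at_top_mono)
  thus "((\<lambda>s. inverse (Complex t s)) \<longlongrightarrow> 0) at_top" "((\<lambda>s. inverse (Complex t s)) \<longlongrightarrow> 0) at_bot"
    by (auto intro: filterlim_compose[OF tendsto_inverse_0])
qed

text \<open>
  The primitive above tends to zero at both ends of the line, so the integral of its
  derivative vanishes. The resulting relation has the same form as \<open>descent_tail_Suc\<close>
  divided by \<open>fact n\<close>.
\<close>
lemma line_integral_Suc:
  assumes t: "t > 0" and n: "n \<ge> 1"
  shows "of_nat (Suc n) * line_integral t (Suc n) y =
    of_real y * line_integral t n y + (of_nat (Suc n) - of_real y) * line_integral t n (y - 1)"
proof -
  let ?z = "\<lambda>s. Complex t s"
  let ?D = "\<lambda>s. of_nat (Suc n) * kernel n (y - 1) (?z s)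
       - of_real y * (kernel n (y - 1) (?z s) - kernel n y (?z s))
       - of_nat (Suc n) * kernel (Suc n) y (?z s)"
  let ?N = "\<lambda>s. (exp (?z s) - 1) ^ Suc n * exp (- (of_real y * ?z s))"
  have z: "?z s \<noteq> 0" for s using Complex_neq_0[OF t] .
  have dz: "(?z has_vector_derivative \<i>) (at s)" for s
    unfolding Complex_eq by (auto intro!: derivative_eq_intros)
  have lim: "((\<lambda>s. ?z s * kernel (Suc n) y (?z s)) \<longlongrightarrow> 0) F"
    if "((\<lambda>s. inverse (?z s)) \<longlongrightarrow> 0) F" for F
  proof -
    have "((\<lambda>s. inverse (?z s) ^ Suc n * ?N s) \<longlongrightarrow> 0) F"
    proof (rule lim_null_mult_right_bounded)
      show "((\<lambda>s. inverse (?z s) ^ Suc n) \<longlongrightarrow> 0) F"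
        using tendsto_power[OF that, of "Suc n"] by simp
      show "\<forall>\<^sub>F s in F. cmod (?N s) \<le> (exp t + 1) ^ Suc n * exp (- (y * t))"
        by (intro always_eventually allI norm_numerator_le)
    qed
    moreover have "?z s * kernel (Suc n) y (?z s) = inverse (?z s) ^ Suc n * ?N s" for s
      using z[of s] by (simp add: kernel_def divide_simps)
    ultimately show ?thesis by simp
  qed
  have "(\<integral>s. ?D s * \<i> \<partial>lborel) = 0"
  proof (rule integral_derivative_vanishing)
    show "((\<lambda>s. ?z s * kernel (Suc n) y (?z s)) has_vector_derivative ?D s * \<i>) (at s)" for s
      using field_vector_diff_chain_at[OF dz DERIV_kernel_primitive[of "?z s" n y, OF z]]
      by (simp add: o_def mult.commute)
    show "continuous_on UNIV (\<lambda>s. ?D s * \<i>)"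
      by (intro continuous_intros continuous_on_kernel[OF t])
    show "integrable lborel (\<lambda>s. ?D s * \<i>)"
      using n by (intro integrable_mult_left Bochner_Integration.integrable_diff integrable_mult_right
          integrable_kernel[OF t]) auto
  qed (rule lim, rule tendsto_inverse_vertical)+
  hence "(\<integral>s. ?D s \<partial>lborel) = 0" by simp
  moreover have "(\<integral>s. ?D s \<partial>lborel) = of_nat (Suc n) * line_integral t n (y - 1)
       - of_real y * (line_integral t n (y - 1) - line_integral t n y)
       - of_nat (Suc n) * line_integral t (Suc n) y"
    unfolding line_integral_def using n
    by (subst Bochner_Integration.integral_diff, (intro Bochner_Integration.integrable_diff integrable_mult_right
          integrable_kernel[OF t]; simp)+)+
       (simp add: integrable_kernel[OF t])
  ultimately show ?thesis by (simp add: algebra_simps)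
qed

section \<open>The inversion integral for one uniform variable\<close>

text \<open>
  The Laplace transform of the ramp function \<open>max 0\<close> is \<open>1 / z\<^sup>2\<close>, so integrating this function
  over a vertical line recovers \<open>max c 0\<close>.
\<close>
definition ramp :: "real \<Rightarrow> complex \<Rightarrow> complex" where
  "ramp c z = exp (of_real c * z) / z\<^sup>2"

lemma ramp_continuous_on: "0 \<notin> A \<Longrightarrow> continuous_on A (ramp c)"
  unfolding ramp_def by (intro continuous_intros) auto

lemma ramp_holomorphic_on: "0 \<notin> A \<Longrightarrow> ramp c holomorphic_on A"
  unfolding ramp_def by (intro holomorphic_intros) auto

lemma ramp_residue: "residue (ramp c) 0 = of_real c"
proof -
  have "residue (\<lambda>z. exp (of_real c * z) / z ^ Suc 1) 0 = (deriv ^^ 1) (\<lambda>z. exp (of_real c * z)) 0 / fact 1"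
    by (rule residue_holomorphic_over_power'[of UNIV]) (auto intro!: holomorphic_intros)
  moreover have "deriv (\<lambda>z. exp (of_real c * z)) 0 = of_real c"
    by (rule DERIV_imp_deriv) (auto intro!: derivative_eq_intros)
  moreover have "ramp c = (\<lambda>z. exp (of_real c * z) / z ^ Suc 1)"
    by (simp add: ramp_def power2_eq_square fun_eq_iff)
  ultimately show ?thesis by simp
qed

lemma contour_integral_rectpath_ramp:
  assumes "a < b" "R > 0" "a \<noteq> 0" "b \<noteq> 0"
  shows "contour_integral (rectpath (Complex a (- R)) (Complex b R)) (ramp c) =
    (if a < 0 \<and> 0 < b then 2 * pi * \<i> * of_real c else 0)"
proof -
  let ?p = "rectpath (Complex a (- R)) (Complex b R)"
  have "contour_integral ?p (ramp c) = 2 * pi * \<i> * (\<Sum>z\<in>{0}. winding_number ?p z * residue (ramp c) z)"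
    using assms
    by (intro Residue_theorem[of UNIV])
       (auto simp: path_image_rectpath intro!: ramp_holomorphic_on)
  moreover have "winding_number ?p 0 = (if a < 0 \<and> 0 < b then 1 else 0)"
    using assms
    by (auto simp: in_box_complex_iff in_cbox_complex_iff
          intro!: winding_number_rectpath winding_number_rectpath_outside)
  ultimately show ?thesis by (simp add: ramp_residue)
qed

lemma contour_integral_rectpath_decompose:
  assumes "continuous_on (path_image (rectpath a1 a3)) f"
  shows "contour_integral (rectpath a1 a3) f =
     contour_integral (linepath a1 (Complex (Re a3) (Im a1))) f
   + contour_integral (linepath (Complex (Re a3) (Im a1)) a3) f
   - contour_integral (linepath (Complex (Re a1) (Im a3)) a3) f
   - contour_integral (linepath a1 (Complex (Re a1) (Im a3))) f"
proof -
  let ?a2 = "Complex (Re a3) (Im a1)" and ?a4 = "Complex (Re a1) (Im a3)"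
  have img: "path_image (rectpath a1 a3) =
      closed_segment a1 ?a2 \<union> closed_segment ?a2 a3 \<union> closed_segment a3 ?a4 \<union> closed_segment ?a4 a1"
    by (auto simp: rectpath_def Let_def path_image_join)
  have int: "f contour_integrable_on linepath p q" if "closed_segment p q \<subseteq> path_image (rectpath a1 a3)" for p q
    using that by (intro contour_integrable_continuous_linepath continuous_on_subset[OF assms(1)])
  have i: "f contour_integrable_on linepath a1 ?a2" "f contour_integrable_on linepath ?a2 a3"
      "f contour_integrable_on linepath a3 ?a4" "f contour_integrable_on linepath ?a4 a1"
    by (rule int; use img in blast)+
  have "contour_integral (rectpath a1 a3) f =
     contour_integral (linepath a1 ?a2) f + contour_integral (linepath ?a2 a3) f
   + contour_integral (linepath a3 ?a4) f + contour_integral (linepath ?a4 a1) f"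
    unfolding rectpath_def Let_def using i by (simp add: contour_integrable_joinI)
  moreover have "contour_integral (linepath a3 ?a4) f = - contour_integral (linepath ?a4 a3) f"
    using contour_integral_reversepath[of "linepath ?a4 a3" f] by simp
  moreover have "contour_integral (linepath ?a4 a1) f = - contour_integral (linepath a1 ?a4) f"
    using contour_integral_reversepath[of "linepath a1 ?a4" f] by simp
  ultimately show ?thesis by simp
qed

lemma ramp_edge_bound:
  assumes "R > 0" and far: "\<And>z. z \<in> closed_segment p q \<Longrightarrow> cmod z \<ge> R \<and> c * Re z \<le> c * t"
  shows "cmod (contour_integral (linepath p q) (ramp c)) \<le> exp (c * t) / R\<^sup>2 * cmod (q - p)"
proof (rule contour_integral_bound_linepath)
  have "0 \<notin> closed_segment p q" using far[of 0] assms(1) by auto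
  thus "ramp c contour_integrable_on linepath p q"
    by (intro contour_integrable_continuous_linepath ramp_continuous_on)
  show "cmod (ramp c z) \<le> exp (c * t) / R\<^sup>2" if "z \<in> closed_segment p q" for z
    using far[OF that] assms(1)
    by (auto simp: ramp_def norm_divide norm_exp_eq_Re norm_power intro!: frac_le power_mono)
qed simp

text \<open>
  Close the segment by three far sides of a rectangle on which \<open>c * Re z \<le> c * t\<close>. For
  \<open>c \<ge> 0\<close> this rectangle lies to the left and contains the pole \<open>0\<close>, whose residue is \<open>c\<close>; for \<open>c < 0\<close> it
  lies to the right and contains no pole. Each far side has length at most \<open>2 * R\<close>, and the integrand is at
  most \<open>exp (c * t) / R\<^sup>2\<close> there.
\<close>
lemma ramp_truncated_integral:
  assumes t: "t > 0" and R: "R > t"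
  shows "cmod (contour_integral (linepath (Complex t (- R)) (Complex t R)) (ramp c) - 2 * pi * \<i> * of_real (max c 0))
    \<le> 6 * exp (c * t) / R"
proof -
  \<comment> \<open>The abscissa of the far vertical side, on the side where \<open>exp (c * Re z)\<close> does not exceed \<open>exp (c * t)\<close>.\<close>
  define d where "d = (if c \<ge> 0 then - R else R)"
  define a where "a = min t d"
  define b where "b = max t d"
  define I where "I = (\<lambda>p q. contour_integral (linepath p q) (ramp c))"
  have ab: "a < b" "a \<noteq> 0" "b \<noteq> 0" "a < 0 \<longleftrightarrow> c \<ge> 0" "b > 0" "b - a \<le> 2 * R"
    using t R by (auto simp: a_def b_def d_def min_def max_def)
  have side: "c * u \<le> c * t" if "a \<le> u" "u \<le> b" for u
    using that t R by (cases "c \<ge> 0") (auto simp: a_def b_def d_def min_def max_def intro: mult_left_mono mult_left_mono_neg)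
  have eq: "(if c \<ge> 0 then 2 * pi * \<i> * of_real c else 0) =
      I (Complex a (- R)) (Complex b (- R)) + I (Complex b (- R)) (Complex b R)
      - I (Complex a R) (Complex b R) - I (Complex a (- R)) (Complex a R)"
  proof -
    have "0 \<notin> path_image (rectpath (Complex a (- R)) (Complex b R))"
      using ab t R by (auto simp: path_image_rectpath)
    thus ?thesis
      using contour_integral_rectpath_ramp[of a b R c] ab t R
        contour_integral_rectpath_decompose[of "Complex a (- R)" "Complex b R" "ramp c"]
      by (auto simp: I_def ramp_continuous_on)
  qed
  have hor: "cmod (I (Complex a h) (Complex b h)) \<le> 2 * exp (c * t) / R" if "\<bar>h\<bar> = R" for h
  proof -
    have "cmod (I (Complex a h) (Complex b h)) \<le> exp (c * t) / R\<^sup>2 * cmod (Complex b h - Complex a h)"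
      unfolding I_def
    proof (rule ramp_edge_bound)
      fix z assume "z \<in> closed_segment (Complex a h) (Complex b h)"
      hence z: "a \<le> Re z" "Re z \<le> b" "Im z = h"
        using ab(1) by (auto simp: closed_segment_same_Im closed_segment_eq_real_ivl)
      thus "cmod z \<ge> R \<and> c * Re z \<le> c * t"
        using abs_Im_le_cmod[of z] that side by auto
    qed (use t R in auto)
    also have "Complex b h - Complex a h = of_real (b - a)" by (simp add: complex_eq_iff)
    also have "exp (c * t) / R\<^sup>2 * cmod (of_real (b - a)) \<le> exp (c * t) / R\<^sup>2 * (2 * R)"
      unfolding norm_of_real using ab by (intro mult_left_mono) auto
    also have "\<dots> = 2 * exp (c * t) / R" using t R by (simp add: power2_eq_square)
    finally show ?thesis .
  qed
  have ver: "cmod (I (Complex d (- R)) (Complex d R)) \<le> 2 * exp (c * t) / R"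
  proof -
    have "cmod (I (Complex d (- R)) (Complex d R)) \<le> exp (c * t) / R\<^sup>2 * cmod (Complex d R - Complex d (- R))"
      unfolding I_def
    proof (rule ramp_edge_bound)
      fix z assume "z \<in> closed_segment (Complex d (- R)) (Complex d R)"
      hence z: "Re z = d" by (auto simp: closed_segment_same_Re)
      thus "cmod z \<ge> R \<and> c * Re z \<le> c * t"
        using abs_Re_le_cmod[of z] side[of d] t R by (auto simp: d_def a_def b_def split: if_splits)
    qed (use t R in auto)
    also have "Complex d R - Complex d (- R) = of_real (2 * R) * \<i>" by (simp add: complex_eq_iff)
    also have "exp (c * t) / R\<^sup>2 * cmod (of_real (2 * R) * \<i>) = 2 * exp (c * t) / R"
      using t R by (simp add: norm_mult power2_eq_square)
    finally show ?thesis .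
  qed
  have bound: "cmod (x + y + z) \<le> 6 * exp (c * t) / R"
    if "cmod x \<le> 2 * exp (c * t) / R" "cmod y \<le> 2 * exp (c * t) / R" "cmod z \<le> 2 * exp (c * t) / R" for x y z
    using norm_triangle_le[of "x + y" z "6 * exp (c * t) / R"] norm_triangle_ineq[of x y] that
    by (simp add: add_divide_distrib[symmetric])
  have "I (Complex t (- R)) (Complex t R) - 2 * pi * \<i> * of_real (max c 0) =
      (if c \<ge> 0 then - I (Complex a (- R)) (Complex b (- R)) else I (Complex a (- R)) (Complex b (- R)))
      + (if c \<ge> 0 then I (Complex a R) (Complex b R) else - I (Complex a R) (Complex b R))
      + I (Complex d (- R)) (Complex d R)"
  proof (cases "c \<ge> 0")
    case True
    hence "a = d" "b = t" using t R by (auto simp: a_def b_def d_def)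
    thus ?thesis using eq True by (simp add: max_def algebra_simps)
  next
    case False
    hence "a = t" "b = d" using t R by (auto simp: a_def b_def d_def)
    thus ?thesis using eq False by (simp add: max_def algebra_simps)
  qed
  also have "cmod \<dots> \<le> 6 * exp (c * t) / R"
    using hor[of R] hor[of "- R"] ver t R by (intro bound) auto
  finally show ?thesis by (simp only: I_def)
qed

lemma integrable_ramp:
  assumes "t > 0"
  shows "integrable lborel (\<lambda>s. ramp c (Complex t s))"
  unfolding ramp_def
  by (rule integrable_vertical[OF assms, where B = "exp (c * t)"])
     (auto intro!: continuous_intros simp: norm_exp_eq_Re)

lemma integral_ramp:
  assumes t: "t > 0"
  shows "(\<integral>s. ramp c (Complex t s) \<partial>lborel) = of_real (2 * pi * max c 0)"
proof (rule LIMSEQ_unique)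
  let ?f = "\<lambda>s. ramp c (Complex t s)"
  have int: "set_integrable lborel A ?f" if "A \<in> sets borel" for A
    using integrable_ramp[OF t, of c] that unfolding set_integrable_def
    by (intro integrable_mult_indicator) auto
  have U: "(\<Union>n. {- real n..real n}) = UNIV"
  proof (intro equalityI subsetI UN_I)
    fix x :: real
    show "x \<in> {- real (nat \<lceil>\<bar>x\<bar>\<rceil>)..real (nat \<lceil>\<bar>x\<bar>\<rceil>)}" by simp linarith
  qed auto
  have "(\<lambda>n. LINT s:{- real n..real n}|lborel. ?f s) \<longlonglongrightarrow> (LINT s:(\<Union>n. {- real n..real n})|lborel. ?f s)"
    by (rule set_integral_cont_up) (auto simp: incseq_def U intro!: int)
  thus "(\<lambda>n. LINT s:{- real n..real n}|lborel. ?f s) \<longlonglongrightarrow> (\<integral>s. ?f s \<partial>lborel)"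
    by (simp add: U set_lebesgue_integral_def)
  have eq: "(LINT s:{- real n..real n}|lborel. ?f s) =
      - \<i> * contour_integral (linepath (Complex t (- real n)) (Complex t (real n))) (ramp c)" if "n > 0" for n
    using that by (subst set_borel_integral_eq_integral[OF int])
      (auto simp: contour_integral_linepath_same_Re[where c = t and a = "- real n" and b = "real n"])
  show "(\<lambda>n. LINT s:{- real n..real n}|lborel. ?f s) \<longlonglongrightarrow> of_real (2 * pi * max c 0)"
  proof (rule LIM_zero_cancel, rule Lim_null_comparison)
    show "\<forall>\<^sub>F n in sequentially. cmod ((LINT s:{- real n..real n}|lborel. ?f s) - of_real (2 * pi * max c 0))
       \<le> 6 * exp (c * t) / real n"
      using eventually_gt_at_top[of "nat \<lceil>t\<rceil>"]
    proof eventually_elim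
      case (elim n)
      hence n: "real n > t" using t by linarith
      let ?I = "contour_integral (linepath (Complex t (- real n)) (Complex t (real n))) (ramp c)"
      have "(LINT s:{- real n..real n}|lborel. ?f s) - of_real (2 * pi * max c 0) =
          - \<i> * (?I - 2 * pi * \<i> * of_real (max c 0))"
        using elim by (simp add: eq algebra_simps)
      thus ?case using ramp_truncated_integral[OF t n, of c] by (simp only: norm_mult) simp
    qed
    show "(\<lambda>n. 6 * exp (c * t) / real n) \<longlonglongrightarrow> 0"
      by (rule lim_const_over_n)
  qed
qed

text \<open>
  The kernel of index \<open>1\<close> is a difference of two ramp integrands. At an integer \<open>y\<close> the right-hand side is
  \<open>2 * pi\<close> if \<open>y \<le> 0\<close> and \<open>0\<close> otherwise.
\<close>
lemma line_integral_1:
  assumes t: "t > 0"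
  shows "line_integral t 1 y = of_real (2 * pi * (max (1 - y) 0 - max (- y) 0))"
proof -
  have "kernel 1 y z = ramp (1 - y) z - ramp (- y) z" for z
    by (simp add: kernel_def ramp_def power2_eq_square ring_distribs exp_add[symmetric] diff_divide_distrib
        flip: exp_add)
  hence "line_integral t 1 y = (\<integral>s. ramp (1 - y) (Complex t s) \<partial>lborel) - (\<integral>s. ramp (- y) (Complex t s) \<partial>lborel)"
    unfolding line_integral_def by (simp add: integrable_ramp[OF t])
  thus ?thesis by (simp only: integral_ramp[OF t]) (simp add: algebra_simps)
qed

text \<open>
  Both sides agree for \<open>n = 1\<close>, where the only permutation has no descent, and satisfy
  the same recursion.
\<close>
lemma descent_tail_eq_line_integral:
  assumes t: "t > 0" and n: "n \<ge> 1"
  shows "line_integral t n (of_int k) = of_real (2 * pi * (real (descent_tail n k) / fact n))"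
  using n
proof (induction n arbitrary: k rule: nat_induct_at_least)
  case base
  have "max (1 - real_of_int k) 0 - max (- real_of_int k) 0 = of_bool (k \<le> 0)" by auto
  thus ?case unfolding line_integral_1[OF t] descent_tail_1 by simp
next
  case (Suc n)
  let ?T = "\<lambda>n k. real (descent_tail n k)"
  have "of_nat (Suc n) * line_integral t (Suc n) (of_int k) =
     of_real (2 * pi / fact n * (of_int k * ?T n k + (real (Suc n) - of_int k) * ?T n (k - 1)))"
  proof -
    have "line_integral t n (of_int k - 1) = of_real (2 * pi * (?T n (k - 1) / fact n))"
      using Suc.IH[of "k - 1"] by simp
    thus ?thesis
      unfolding line_integral_Suc[OF t Suc.hyps] Suc.IH[of k] by (simp add: algebra_simps add_divide_distrib diff_divide_distrib)
  qed
  also have "\<dots> = of_real (2 * pi / fact n * ?T (Suc n) k)"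
    by (simp only: descent_tail_Suc[OF Suc.hyps])
  finally have "line_integral t (Suc n) (of_int k) = of_real (2 * pi / fact n * ?T (Suc n) k) / of_nat (Suc n)"
    by (simp add: field_simps del: of_nat_Suc)
  thus ?case by (simp add: field_simps)
qed

section \<open>Gaussian behaviour of the tilted characteristic function\<close>

text \<open>
  A bound \<open>cmod (f' v) \<le> e / 2 * cmod v\<close> near \<open>0\<close> integrates to \<open>cmod (f w) \<le> e / 2 * (cmod w)\<^sup>2\<close>. This gives a
  second-order Taylor estimate that needs the second derivative at the centre only.
\<close>
lemma second_order_vanishing:
  fixes f f' :: "complex \<Rightarrow> complex"
  assumes r: "r > 0" and der: "\<And>w. cmod w < r \<Longrightarrow> (f has_field_derivative f' w) (at w)"
    and der0: "(f' has_field_derivative 0) (at 0)" and "f' 0 = 0" "f 0 = 0"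
  shows "((\<lambda>w. f w / w\<^sup>2) \<longlongrightarrow> 0) (at 0)"
proof (rule LIM_I)
  fix e :: real assume e: "e > 0"
  have quot: "((\<lambda>w. f' w / w) \<longlongrightarrow> 0) (at 0)"
    using der0 assms(4) by (simp add: DERIV_def)
  have "e / 2 > 0" using e by simp
  from LIM_D[OF quot this] obtain d where
    d: "d > 0" "\<forall>w. w \<noteq> 0 \<and> cmod (w - 0) < d \<longrightarrow> cmod (f' w / w - 0) < e / 2"
    by blast
  show "\<exists>s>0. \<forall>w. w \<noteq> 0 \<and> cmod (w - 0) < s \<longrightarrow> cmod (f w / w\<^sup>2 - 0) < e"
  proof (intro exI[of _ "min d r"] conjI allI impI)
    fix w :: complex assume w: "w \<noteq> 0 \<and> cmod (w - 0) < min d r"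
    have small: "cmod (f' v) \<le> e / 2 * cmod w" if v: "v \<in> cball 0 (cmod w)" for v
    proof (cases "v = 0")
      case False
      have "v \<noteq> 0 \<and> cmod (v - 0) < d" using False v w by simp
      hence "cmod (f' v / v - 0) < e / 2" using d(2) by blast
      hence "cmod (f' v) < e / 2 * cmod v"
        using False by (simp add: norm_divide pos_divide_less_eq)
      also have "\<dots> \<le> e / 2 * cmod w"
        using v e by (intro mult_left_mono) simp_all
      finally show ?thesis by (rule less_imp_le)
    qed (use e assms(4) in simp)
    have "cmod (f w - f 0) \<le> (e / 2 * cmod w) * cmod (w - 0)"
    proof (rule field_differentiable_bound[OF convex_cball _ small])
      fix v assume "v \<in> cball (0 :: complex) (cmod w)"
      hence "cmod v < r" using w by simp
      thus "(f has_field_derivative f' v) (at v within cball 0 (cmod w))"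
        by (rule has_field_derivative_at_within[OF der])
    qed simp_all
    hence le: "cmod (f w) \<le> e / 2 * (cmod w)\<^sup>2"
      by (simp add: assms(5) power2_eq_square mult.assoc)
    have "(cmod w)\<^sup>2 > 0" using w by simp
    hence "cmod (f w / w\<^sup>2) \<le> e / 2"
      using le by (simp only: norm_divide norm_power pos_divide_le_eq)
    also have "\<dots> < e" using e by simp
    finally show "cmod (f w / w\<^sup>2 - 0) < e" by (simp only: diff_zero)
  qed (use d(1) r in simp)
qed

text \<open>
  On the real axis this is the characteristic function of \<open>U - L' t\<close>, where \<open>U\<close> has the density
  proportional to \<open>exp (t * u)\<close> on \<open>[0, 1]\<close>. It is defined for complex arguments so that its expansion at
  \<open>0\<close> can be found by complex differentiation.
\<close>
definition tilted_char :: "real \<Rightarrow> complex \<Rightarrow> complex" where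
  "tilted_char t w = (exp (of_real t + \<i> * w) - 1) / (of_real t + \<i> * w) *
     of_real (t / (exp t - 1)) * exp (- (\<i> * of_real (L' t) * w))"

lemma tilted_char_0: "t > 0 \<Longrightarrow> tilted_char t 0 = 1"
  by (simp add: tilted_char_def exp_of_real)

lemma DERIV_tilted_char:
  assumes t: "t > 0" and w: "cmod w < t"
  defines "z \<equiv> of_real t + \<i> * w"
  shows "(tilted_char t has_field_derivative
     \<i> * (exp z / (exp z - 1) - 1 / z - of_real (L' t)) * tilted_char t w) (at w)"
proof -
  have re: "Re z > 0"
    using abs_Im_le_cmod[of w] w by (simp add: z_def)
  hence z: "z \<noteq> 0" by auto
  have "cmod (exp z) > 1" using re by (simp add: norm_exp_eq_Re)
  hence E: "exp z - 1 \<noteq> 0" by (metis eq_iff_diff_eq_0 norm_one less_irrefl)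
  define E where "E = exp z"
  define e where "e = exp (- (\<i> * of_real (L' t) * w))"
  show ?thesis
    unfolding tilted_char_def[abs_def]
    apply (rule derivative_eq_intros refl | use z in \<open>force simp: z_def\<close>)+
    apply (simp only: z_def[symmetric] e_def[symmetric])
    using z E unfolding E_def[symmetric]
    apply (simp add: divide_simps)
    apply (simp add: algebra_simps)
    done
qed

text \<open>
  The centring by \<open>L' t\<close> removes the first derivative at \<open>0\<close>, and the second derivative is
  minus the variance \<open>L'' t\<close>, exactly as for the Gaussian factor.
\<close>
lemma tilted_char_gaussian:
  assumes t: "t > 0"
  shows "((\<lambda>w. (tilted_char t w - exp (- (of_real (L'' t) * w\<^sup>2 / 2))) / w\<^sup>2) \<longlongrightarrow> 0) (at 0)"
proof -
  let ?l = "\<lambda>w. exp (of_real t + \<i> * w) / (exp (of_real t + \<i> * w) - 1) - 1 / (of_real t + \<i> * w) - of_real (L' t) :: complex"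
  let ?f' = "\<lambda>w. \<i> * ?l w * tilted_char t w + of_real (L'' t) * w * exp (- (of_real (L'' t) * w\<^sup>2 / 2))"
  have E: "exp (of_real t) - 1 \<noteq> (0 :: complex)"
    using t by (simp add: exp_of_real)
  have l0: "?l 0 = 0" using t by (simp add: L'_def flip: exp_of_real)
  have dl: "(?l has_field_derivative \<i> * of_real (L'' t)) (at 0)"
    apply (rule derivative_eq_intros refl | use E t in force)+
    using E t apply (simp add: L''_def exp_of_real[symmetric] divide_simps power2_eq_square)
    apply (simp add: algebra_simps)
    done
  show ?thesis
  proof (rule second_order_vanishing[OF t, where f' = ?f'])
    fix w assume w: "cmod w < t"
    have "((\<lambda>w. exp (- (of_real (L'' t) * w\<^sup>2 / 2))) has_field_derivative
        - (of_real (L'' t) * w * exp (- (of_real (L'' t) * w\<^sup>2 / 2)))) (at w)"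
      by (auto intro!: derivative_eq_intros)
    from DERIV_diff[OF DERIV_tilted_char[OF t w] this]
    show "((\<lambda>w. tilted_char t w - exp (- (of_real (L'' t) * w\<^sup>2 / 2))) has_field_derivative ?f' w) (at w)"
      by simp
  next
    have "(tilted_char t has_field_derivative 0) (at 0)"
      using DERIV_tilted_char[OF t, of 0, unfolded l0] t by simp
    from DERIV_mult[OF DERIV_cmult[OF dl, of \<i>] this]
    have "((\<lambda>w. \<i> * ?l w * tilted_char t w) has_field_derivative - of_real (L'' t)) (at 0)"
      by (rule DERIV_cong) (use t in \<open>simp add: tilted_char_0\<close>)
    moreover have "((\<lambda>w. of_real (L'' t) * w * exp (- (of_real (L'' t) * w\<^sup>2 / 2)))
        has_field_derivative of_real (L'' t)) (at 0)"
      by (auto intro!: derivative_eq_intros)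
    ultimately show "(?f' has_field_derivative 0) (at 0)"
      by (rule DERIV_cong[OF DERIV_add]) simp
  next
    show "?f' 0 = 0" unfolding l0 by simp
    show "tilted_char t 0 - exp (- (of_real (L'' t) * 0\<^sup>2 / 2)) = 0"
      by (simp add: tilted_char_0[OF t])
  qed
qed

text \<open>
  With \<open>v = 2 * (1 - cos s)\<close> and \<open>A = exp t / (exp t - 1)\<^sup>2\<close> the squared modulus is
  \<open>(1 + A * v) / (1 + s\<^sup>2 / t\<^sup>2)\<close>. Since \<open>v\<close> is at most both \<open>s\<^sup>2\<close> and \<open>4\<close>, the constant \<open>c\<close> defined by
  \<open>A + c * (1 + 4 * A) = 1 / t\<^sup>2\<close> works. It is positive because \<open>1 / t\<^sup>2 - A = L'' t\<close>. One bound thus covers both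
  the Gaussian decay near \<open>0\<close> and the decay of order \<open>1 / s\<close> at infinity.
\<close>
lemma norm_tilted_char_le:
  assumes t: "t > 0"
  obtains c where "c > 0" "\<And>s. (cmod (tilted_char t (of_real s)))\<^sup>2 \<le> 1 / (1 + c * s\<^sup>2)"
proof -
  define A where "A = exp t / (exp t - 1)\<^sup>2"
  define c where "c = L'' t / (1 + 4 * A)"
  have A: "A > 0" using t by (simp add: A_def)
  have c: "c > 0" using A L''_pos[OF t] by (simp add: c_def add_pos_pos)
  have cA: "A + c * (1 + 4 * A) = 1 / t\<^sup>2"
    using A by (simp add: c_def L''_def A_def)
  have "(cmod (tilted_char t (of_real s)))\<^sup>2 \<le> 1 / (1 + c * s\<^sup>2)" for s
  proof -
    define v where "v = 2 * (1 - cos s)"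
    have v: "v = 4 * (sin (s / 2))\<^sup>2"
      using cos_double_sin[of "s / 2"] by (simp add: v_def)
    have v4: "v \<le> 4"
      using sin_squared_eq[of "s / 2"] zero_le_power2[of "cos (s / 2)"] by (simp add: v)
    have vs: "v \<le> s\<^sup>2"
    proof -
      have "\<bar>sin (s / 2)\<bar>\<^sup>2 \<le> \<bar>s / 2\<bar>\<^sup>2" by (intro power_mono abs_sin_x_le_abs_x) auto
      thus ?thesis by (simp add: v power_divide)
    qed
    have z: "of_real t + \<i> * of_real s = Complex t s" by (simp add: complex_eq_iff)
    have "(cmod (exp (Complex t s) - 1))\<^sup>2 = (exp t * cos s - 1)\<^sup>2 + (exp t * sin s)\<^sup>2"
      by (simp add: cmod_power2 Re_exp Im_exp)
    also have "\<dots> = (exp t)\<^sup>2 * ((cos s)\<^sup>2 + (sin s)\<^sup>2) - 2 * exp t * cos s + 1"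
      by algebra
    also have "\<dots> = (exp t - 1)\<^sup>2 + exp t * v"
      by (simp add: v_def power2_eq_square algebra_simps)
    finally have num: "(cmod (exp (Complex t s) - 1))\<^sup>2 = (exp t - 1)\<^sup>2 + exp t * v" .
    have den: "(cmod (Complex t s))\<^sup>2 = t\<^sup>2 + s\<^sup>2" by (simp add: cmod_power2)
    have "(cmod (tilted_char t (of_real s)))\<^sup>2 =
        ((exp t - 1)\<^sup>2 + exp t * v) / (t\<^sup>2 + s\<^sup>2) * (t\<^sup>2 / (exp t - 1)\<^sup>2)"
      using t unfolding tilted_char_def z
      by (simp add: norm_mult norm_divide norm_exp_eq_Re power_mult_distrib power_divide num den
          del: of_real_divide)
    also have "\<dots> = (1 + A * v) / (1 + s\<^sup>2 / t\<^sup>2)"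
      using t by (simp add: A_def divide_simps add_pos_nonneg)
    also have "\<dots> \<le> 1 / (1 + c * s\<^sup>2)"
    proof -
      have "A * v + c * s\<^sup>2 * (1 + A * v) \<le> A * s\<^sup>2 + c * s\<^sup>2 * (1 + A * 4)"
        using A c v4 vs by (intro add_mono mult_left_mono) auto
      also have "\<dots> = s\<^sup>2 * (A + c * (1 + 4 * A))" by (simp add: algebra_simps)
      finally have "(1 + A * v) * (1 + c * s\<^sup>2) \<le> 1 + s\<^sup>2 / t\<^sup>2"
        unfolding cA by (simp add: algebra_simps)
      moreover have "1 + c * s\<^sup>2 > 0" "1 + s\<^sup>2 / t\<^sup>2 > 0"
        using c t by (auto intro!: add_pos_nonneg)
      ultimately show ?thesis by (simp add: pos_le_divide_eq pos_divide_le_eq)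
    qed
    finally show ?thesis .
  qed
  thus ?thesis using that c by blast
qed

text \<open>
  The right-hand side increases with \<open>n\<close> and equals the left-hand side at \<open>n = 2\<close>. This makes the
  dominating function in \<open>local_limit\<close> independent of \<open>n\<close>.
\<close>
lemma power_ge_quadratic:
  fixes a :: real
  assumes "a \<ge> 0" "n \<ge> 2"
  shows "(1 + a / 2)\<^sup>2 \<le> (1 + a / real n) ^ n"
proof -
  have *: "1 + real m * b + real m * (real m - 1) / 2 * b\<^sup>2 \<le> (1 + b) ^ m" if "b \<ge> 0" for b m
  proof (induction m)
    case (Suc m)
    have "1 + real (Suc m) * b + real (Suc m) * (real (Suc m) - 1) / 2 * b\<^sup>2
        \<le> (1 + b) * (1 + real m * b + real m * (real m - 1) / 2 * b\<^sup>2)"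
    proof -
      have "0 \<le> real m * (real m - 1) / 2 * b ^ 3"
        using that by (cases m) auto
      thus ?thesis by (simp add: field_simps power2_eq_square power3_eq_cube)
    qed
    also have "\<dots> \<le> (1 + b) * (1 + b) ^ m" using that Suc by (intro mult_left_mono) auto
    finally show ?case by simp
  qed simp
  have n: "real n \<ge> 2" using assms by simp
  have "real n * (real n - 1) / 2 * (a / n)\<^sup>2 = a\<^sup>2 * ((real n - 1) / (2 * real n))"
    using n by (simp add: power2_eq_square)
  moreover have "a\<^sup>2 * ((real n - 1) / (2 * real n)) \<ge> a\<^sup>2 * (1 / 4)"
    using n by (intro mult_left_mono) (auto simp: divide_simps)
  moreover have "real n * (a / n) = a" using n by simp
  moreover have "1 + real n * (a / n) + real n * (real n - 1) / 2 * (a / n)\<^sup>2 \<le> (1 + a / n) ^ n"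
    using assms by (intro *) auto
  moreover have "(1 + a / 2)\<^sup>2 = 1 + a + a\<^sup>2 * (1 / 4)"
    by (simp add: power2_eq_square algebra_simps)
  ultimately show ?thesis by linarith
qed

text \<open>
  Two numbers in the unit disc satisfy \<open>cmod (z ^ n - w ^ n) \<le> n * cmod (z - w)\<close>. Applied to the
  characteristic function and the Gaussian at \<open>u / sqrt n\<close>, this is \<open>u\<^sup>2\<close> times the quotient
  that tends to zero by \<open>tilted_char_gaussian\<close>.
\<close>
lemma tilted_char_power_tendsto:
  assumes t: "t > 0"
  shows "(\<lambda>n. tilted_char t (of_real (u / sqrt (real n))) ^ n) \<longlonglongrightarrow> of_real (exp (- (L'' t * u\<^sup>2 / 2)))"
proof (cases "u = 0")
  case True
  thus ?thesis using t by (simp add: tilted_char_0)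
next
  case u: False
  let ?g = "\<lambda>w::complex. exp (- (of_real (L'' t) * w\<^sup>2 / 2))"
  let ?w = "\<lambda>n. complex_of_real (u / sqrt (real n))"
  let ?h = "\<lambda>w. (tilted_char t w - ?g w) / w\<^sup>2"
  have "(\<lambda>n. u / sqrt (real n)) \<longlonglongrightarrow> 0" by real_asymp
  hence "?w \<longlonglongrightarrow> of_real 0" by (rule tendsto_of_real)
  hence "?w \<longlonglongrightarrow> 0" by (simp only: of_real_0)
  hence "filterlim ?w (at 0) sequentially"
    using u eventually_gt_at_top[of 0] by (auto simp: filterlim_at elim!: eventually_mono)
  hence "(\<lambda>n. ?h (?w n)) \<longlonglongrightarrow> 0"
    using tilted_char_gaussian[OF t] by (rule filterlim_compose[rotated])
  hence lim: "(\<lambda>n. u\<^sup>2 * cmod (?h (?w n))) \<longlonglongrightarrow> 0"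
    by (intro tendsto_mult_right_zero tendsto_norm_zero)
  obtain c where c: "c > 0" "\<And>s. (cmod (tilted_char t (of_real s)))\<^sup>2 \<le> 1 / (1 + c * s\<^sup>2)"
    using norm_tilted_char_le[OF t] by blast
  have le1: "cmod (tilted_char t (of_real s)) \<le> 1" for s
  proof -
    have "1 / (1 + c * s\<^sup>2) \<le> 1" using c(1) by (simp add: divide_simps add_pos_nonneg)
    hence "(cmod (tilted_char t (of_real s)))\<^sup>2 \<le> 1\<^sup>2" using c(2)[of s] by simp
    thus ?thesis by (rule power2_le_imp_le) simp
  qed
  show ?thesis
  proof (rule LIM_zero_cancel, rule Lim_null_comparison[OF _ lim])
    show "\<forall>\<^sub>F n in sequentially. cmod (tilted_char t (?w n) ^ n - of_real (exp (- (L'' t * u\<^sup>2 / 2))))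
        \<le> u\<^sup>2 * cmod (?h (?w n))"
      using eventually_gt_at_top[of 0]
    proof eventually_elim
      case (elim n)
      have w2: "(u / sqrt (real n))\<^sup>2 = u\<^sup>2 / real n" using elim by (simp add: power_divide)
      have g: "?g (?w n) = of_real (exp (- (L'' t * (u\<^sup>2 / real n) / 2)))"
        unfolding w2[symmetric] by (simp add: exp_of_real[symmetric])
      have "?g (?w n) ^ n = of_real (exp (real n * (- (L'' t * (u\<^sup>2 / real n) / 2))))"
        by (simp only: g of_real_power exp_of_nat_mult)
      also have "real n * (- (L'' t * (u\<^sup>2 / real n) / 2)) = - (L'' t * u\<^sup>2 / 2)"
        using elim by simp
      finally have gn: "of_real (exp (- (L'' t * u\<^sup>2 / 2))) = ?g (?w n) ^ n" ..
      have "cmod (?g (?w n)) \<le> 1"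
        unfolding g norm_of_real using L''_pos[OF t] by simp
      hence "cmod (tilted_char t (?w n) ^ n - ?g (?w n) ^ n) \<le> real n * cmod (tilted_char t (?w n) - ?g (?w n))"
        by (intro norm_power_diff le1)
      also have "\<dots> = u\<^sup>2 * cmod (?h (?w n))"
        using elim u by (simp add: norm_divide norm_power power_divide del: of_real_divide)
      finally show ?case unfolding gn .
    qed
  qed
qed

lemma integral_gaussian:
  assumes "v > 0"
  shows "(\<integral>u. exp (- (v * u\<^sup>2 / 2)) \<partial>lborel) = sqrt (2 * pi) / sqrt v"
proof -
  have s: "1 / sqrt v > 0" using assms by simp
  have "exp (- (v * u\<^sup>2 / 2)) = sqrt (2 * pi) / sqrt v * normal_density 0 (1 / sqrt v) u" for u
    using assms by (simp add: normal_density_def power_divide real_sqrt_divide real_sqrt_mult mult.commute)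
  thus ?thesis using s by simp
qed

lemma continuous_on_tilted_char:
  assumes "t > 0"
  shows "continuous_on A (\<lambda>s. tilted_char t (of_real (b * s)))"
proof -
  have "of_real t + \<i> * complex_of_real r = Complex t r" for r
    by (simp add: complex_eq_iff)
  thus ?thesis
    unfolding tilted_char_def using Complex_neq_0[OF assms]
    by (simp only:) (intro continuous_intros; blast)
qed

text \<open>
  After the substitution \<open>s = u / sqrt n\<close> the integrands converge pointwise: the bounded shifts \<open>g n\<close>
  are scaled away and \<open>1 / z\<close> becomes \<open>1 / t\<close>. For \<open>n \<ge> 2\<close> they are dominated by \<open>1 / t\<close> times
  \<open>1 / (1 + c / 2 * u\<^sup>2)\<close>.
\<close>
lemma local_limit:
  assumes t: "t > 0" and g: "\<And>n. \<bar>g n\<bar> \<le> 1"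
  shows "(\<lambda>n. of_real (sqrt (real n)) *
      (\<integral>s. tilted_char t (of_real s) ^ n * exp (- (\<i> * of_real (g n * s))) / Complex t s \<partial>lborel))
    \<longlonglongrightarrow> of_real (sqrt (2 * pi) / (sqrt (L'' t) * t))"
proof -
  let ?h = "\<lambda>n s. tilted_char t (of_real s) ^ n * exp (- (\<i> * of_real (g n * s))) / Complex t s"
  let ?G = "\<lambda>n u. ?h n (1 / sqrt (real n) * u)"
  have scale: "of_real (sqrt (real n)) * (\<integral>s. ?h n s \<partial>lborel) = (\<integral>u. ?G n u \<partial>lborel)" if "n > 0" for n
    using that by (subst lborel_integral_real_affine[where c = "1 / sqrt (real n)" and t = 0])
      (simp_all add: scaleR_conv_of_real)
  obtain c where c: "c > 0" "\<And>s. (cmod (tilted_char t (of_real s)))\<^sup>2 \<le> 1 / (1 + c * s\<^sup>2)"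
    using norm_tilted_char_le[OF t] by blast
  \<comment> \<open>The bound on the power is of order \<open>1 / \<bar>u\<bar> ^ n\<close>, hence integrable only from index 2 on.\<close>
  have "(\<lambda>n. \<integral>u. ?G (n + 2) u \<partial>lborel) \<longlonglongrightarrow> (\<integral>u. of_real (exp (- (L'' t * u\<^sup>2 / 2))) * 1 / Complex t 0 \<partial>lborel)"
  proof (rule integral_dominated_convergence[where w = "\<lambda>u. 1 / t * (1 / (1 + c / 2 * u\<^sup>2))"])
    show "integrable lborel (\<lambda>u. 1 / t * (1 / (1 + c / 2 * u\<^sup>2)))"
      using c by (intro integrable_mult_right integrable_inverse_quadratic) auto
    show "(\<lambda>u. ?G (n + 2) u) \<in> borel_measurable lborel" for n
      unfolding measurable_lborel2 using Complex_neq_0[OF t]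
      by (intro borel_measurable_continuous_onI continuous_intros continuous_on_tilted_char t) auto
    show "AE u in lborel. cmod (?G (n + 2) u) \<le> 1 / t * (1 / (1 + c / 2 * u\<^sup>2))" for n
    proof (rule AE_I2)
      fix u
      define m where "m = n + 2"
      define s where "s = 1 / sqrt (real m) * u"
      have m: "m \<ge> 2" by (simp add: m_def)
      have s2: "c * s\<^sup>2 = c * u\<^sup>2 / real m" using m by (simp add: s_def power_mult_distrib power_divide)
      have pos: "1 + c / 2 * u\<^sup>2 > 0" using c by (intro add_pos_nonneg) auto
      have "(cmod (tilted_char t (of_real s) ^ m))\<^sup>2 = ((cmod (tilted_char t (of_real s)))\<^sup>2) ^ m"
        by (simp only: norm_power power_mult[symmetric] mult.commute[of m])
      also have "\<dots> \<le> (1 / (1 + c * s\<^sup>2)) ^ m" by (intro power_mono c) auto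
      also have "\<dots> = 1 / (1 + c * u\<^sup>2 / real m) ^ m" unfolding s2 by (simp add: power_divide)
      also have "\<dots> \<le> 1 / (1 + c * u\<^sup>2 / 2)\<^sup>2"
        using power_ge_quadratic[of "c * u\<^sup>2" m] m c
        by (intro divide_left_mono) (auto intro!: mult_pos_pos zero_less_power add_pos_nonneg)
      also have "\<dots> = (1 / (1 + c / 2 * u\<^sup>2))\<^sup>2" by (simp add: power_divide)
      finally have "cmod (tilted_char t (of_real s) ^ m) \<le> 1 / (1 + c / 2 * u\<^sup>2)"
        by (rule power2_le_imp_le) (use pos in simp)
      hence "cmod (tilted_char t (of_real s) ^ m) / cmod (Complex t s) \<le> (1 / (1 + c / 2 * u\<^sup>2)) / t"
        using pos by (intro frac_le norm_vertical_ge t) auto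
      moreover have "cmod (?h m s) = cmod (tilted_char t (of_real s) ^ m) / cmod (Complex t s)"
        by (simp add: norm_divide norm_mult norm_exp_eq_Re)
      moreover have "(1 / (1 + c / 2 * u\<^sup>2)) / t = 1 / t * (1 / (1 + c / 2 * u\<^sup>2))"
        by simp
      ultimately show "cmod (?G (n + 2) u) \<le> 1 / t * (1 / (1 + c / 2 * u\<^sup>2))"
        unfolding m_def[symmetric] s_def[symmetric] by (simp only:)
    qed
    show "AE u in lborel. (\<lambda>n. ?G (n + 2) u) \<longlonglongrightarrow> of_real (exp (- (L'' t * u\<^sup>2 / 2))) * 1 / Complex t 0"
    proof (rule AE_I2, rule LIMSEQ_ignore_initial_segment[where f = "\<lambda>n. ?G n u" for u])
      fix u
      have "(\<lambda>n. g n * (u / sqrt (real n))) \<longlonglongrightarrow> 0"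
      proof (rule Lim_null_comparison)
        show "\<forall>\<^sub>F n in sequentially. norm (g n * (u / sqrt (real n))) \<le> \<bar>u\<bar> / sqrt (real n)"
          using mult_right_mono[OF g, of "\<bar>u\<bar> / sqrt (real n)" for n]
          by (auto simp: abs_mult intro!: always_eventually)
        show "(\<lambda>n. \<bar>u\<bar> / sqrt (real n)) \<longlonglongrightarrow> 0" by real_asymp
      qed
      hence "(\<lambda>n. exp (- (\<i> * complex_of_real (g n * (u / sqrt (real n)))))) \<longlonglongrightarrow> exp (- (\<i> * of_real 0))"
        by (intro tendsto_intros)
      moreover have "(\<lambda>n. Complex t (u / sqrt (real n))) \<longlonglongrightarrow> Complex t 0"
        by (intro tendsto_Complex tendsto_const) real_asymp
      ultimately have "(\<lambda>n. tilted_char t (of_real (u / sqrt (real n))) ^ n *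
           exp (- (\<i> * complex_of_real (g n * (u / sqrt (real n))))) / Complex t (u / sqrt (real n)))
        \<longlonglongrightarrow> of_real (exp (- (L'' t * u\<^sup>2 / 2))) * exp (- (\<i> * of_real 0)) / Complex t 0"
        by (intro tendsto_divide tendsto_mult tilted_char_power_tendsto[OF t] Complex_neq_0[OF t])
      thus "(\<lambda>n. ?G n u) \<longlonglongrightarrow> of_real (exp (- (L'' t * u\<^sup>2 / 2))) * 1 / Complex t 0"
        by simp
    qed
  qed (simp_all add: complex_eq_iff)
  moreover have "(\<integral>u. of_real (exp (- (L'' t * u\<^sup>2 / 2))) * 1 / Complex t 0 \<partial>lborel) =
      of_real (sqrt (2 * pi) / (sqrt (L'' t) * t))"
  proof -
    have "Complex t 0 = of_real t" by (simp add: complex_eq_iff)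
    hence "(\<integral>u. of_real (exp (- (L'' t * u\<^sup>2 / 2))) * 1 / Complex t 0 \<partial>lborel) =
        (\<integral>u. complex_of_real (exp (- (L'' t * u\<^sup>2 / 2)) / t) \<partial>lborel)" by simp
    also have "\<dots> = of_real (\<integral>u. exp (- (L'' t * u\<^sup>2 / 2)) / t \<partial>lborel)"
      by (rule integral_complex_of_real)
    finally show ?thesis using integral_gaussian[OF L''_pos[OF t]] by simp
  qed
  ultimately have "(\<lambda>n. \<integral>u. ?G (n + 2) u \<partial>lborel) \<longlonglongrightarrow> of_real (sqrt (2 * pi) / (sqrt (L'' t) * t))"
    by simp
  hence "(\<lambda>n. \<integral>u. ?G n u \<partial>lborel) \<longlonglongrightarrow> of_real (sqrt (2 * pi) / (sqrt (L'' t) * t))"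
    by (rule LIMSEQ_offset)
  thus ?thesis
    by (rule Lim_transform_eventually)
       (use eventually_gt_at_top[of 0] in \<open>eventually_elim, simp only: scale\<close>)
qed

text \<open>
  Dividing the kernel by its modulus at \<open>s = 0\<close>, up to the factor \<open>1 / z\<close>, leaves the normalised characteristic
  function. The part \<open>n * L' t\<close> of the threshold is absorbed by the centring; only the remainder \<open>g\<close>
  is left as a phase.
\<close>
lemma kernel_tilt:
  assumes t: "t > 0"
  shows "kernel n (real n * L' t + g) (Complex t s) =
    of_real (exp (real n * L t - (real n * L' t + g) * t)) *
    (tilted_char t (of_real s) ^ n * exp (- (\<i> * of_real (g * s))) / Complex t s)"
proof -
  define y where "y = real n * L' t + g"
  define z where "z = Complex t s"
  define q where "q = ((exp z - 1) / z) ^ n"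
  define m where "m = complex_of_real (((exp t - 1) / t) ^ n)"
  define m' where "m' = complex_of_real ((t / (exp t - 1)) ^ n)"
  define e where "e = complex_of_real (exp (- (y * t)))"
  define a where "a = exp (- (\<i> * of_real (real n * L' t * s)))"
  define b where "b = exp (- (\<i> * of_real (g * s)))"
  have z: "of_real t + \<i> * of_real s = z" by (simp add: complex_eq_iff z_def)
  have "real n * L t = ln (((exp t - 1) / t) ^ n)"
    using t by (simp add: L_def ln_realpow)
  hence "exp (real n * L t - y * t) = ((exp t - 1) / t) ^ n * exp (- (y * t))"
    using t by (simp add: exp_diff exp_minus divide_inverse)
  hence tilt: "complex_of_real (exp (real n * L t - y * t)) = m * e"
    by (simp only: m_def e_def of_real_mult)
  have char: "tilted_char t (of_real s) ^ n = q * m' * a"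
    unfolding tilted_char_def z power_mult_distrib q_def m'_def a_def of_real_power
      exp_of_nat_mult[symmetric]
    by (simp add: mult_ac)
  have "((exp t - 1) / t) ^ n * (t / (exp t - 1)) ^ n = 1"
    using t by (simp flip: power_mult_distrib)
  hence m: "m * m' = 1"
    unfolding m_def m'_def by (metis of_real_1 of_real_mult)
  have "exp (- (of_real y * z)) = e * a * b"
    by (simp add: e_def a_def b_def y_def z_def Complex_eq algebra_simps exp_of_real[symmetric]
        flip: exp_add)
  hence "kernel n y z = (m * m') * (q * (e * a * b) / z)"
    by (simp add: kernel_def q_def m power_divide)
  also have "\<dots> = m * e * (q * m' * a * b / z)" by simp
  finally show ?thesis unfolding y_def[symmetric] z_def[symmetric] char tilt b_def[symmetric] .
qed

section \<open>The sharp large deviation estimate\<close>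

theorem theorem3p1:
  fixes x :: real
  assumes "1 / 2 < x" and "x < 1"
  shows "\<exists>\<epsilon> :: nat \<Rightarrow> real. \<epsilon> \<in> o[at_top](\<lambda>_. 1) \<and>
    (\<forall>n\<ge>1.
      measure_pmf.prob (uniform_perm n) {\<pi>. real (descent_count n \<pi>) / real n \<ge> x} =
        exp (- real n * rate_function x - ceil_gap (real n * x) * saddle x) /
        (tilted_sd x * saddle x * sqrt (2 * pi * real n)) * (1 + \<epsilon> n))"
proof -
  define t where "t = saddle x"
  have t: "t > 0" and Lx: "L' t = x"
    using saddle_pos[OF assms] L'_saddle[OF assms] by (simp_all add: t_def)
  define \<sigma> where "\<sigma> = sqrt (L'' t)"
  have \<sigma>: "\<sigma> > 0" using L''_pos[OF t] by (simp add: \<sigma>_def)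
  have sd: "tilted_sd x = \<sigma>" using tilted_sd_eq[OF assms] by (simp add: \<sigma>_def t_def)
  \<comment> \<open>The integer threshold \<open>\<lceil>n x\<rceil>\<close> exceeds \<open>n x\<close> by \<open>g n\<close>, which stays bounded and so does not affect the limit of \<open>K\<close>.\<close>
  define g where "g n = ceil_gap (real n * x)" for n
  define P where "P n = measure_pmf.prob (uniform_perm n) {\<pi>. real (descent_count n \<pi>) / real n \<ge> x}" for n
  define R where "R n = exp (- real n * rate_function x - g n * t) / (\<sigma> * t * sqrt (2 * pi * real n))" for n
  define K where "K n = of_real (sqrt (real n)) *
      (\<integral>s. tilted_char t (of_real s) ^ n * exp (- (\<i> * of_real (g n * s))) / Complex t s \<partial>lborel)" for n
  have g: "\<bar>g n\<bar> \<le> 1" for n unfolding g_def ceil_gap_def by linarith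
  have K: "K \<longlonglongrightarrow> of_real (sqrt (2 * pi) / (\<sigma> * t))"
    unfolding K_def[abs_def] \<sigma>_def by (rule local_limit[OF t g])
  have ratio: "complex_of_real (P n / R n) = K n * of_real (\<sigma> * t / sqrt (2 * pi))" if n: "n \<ge> 1" for n
  proof -
    define k where "k = \<lceil>real n * x\<rceil>"
    define a where "a = exp (- real n * rate_function x - g n * t)"
    have k: "real_of_int k = real n * x + g n" by (simp add: g_def ceil_gap_def k_def)
    have "{\<pi>. real (descent_count n \<pi>) / real n \<ge> x} = {\<pi>. k \<le> int (descent_count n \<pi>)}"
      using n by (auto simp: k_def ceiling_le_iff field_simps)
    hence "complex_of_real (2 * pi * P n) = line_integral t n (of_int k)"
      using descent_tail_eq_line_integral[OF t n, of k] by (simp add: P_def prob_descent_count_ge)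
    also have "\<dots> = of_real (exp (real n * L t - (real n * x + g n) * t)) *
       (\<integral>s. tilted_char t (of_real s) ^ n * exp (- (\<i> * of_real (g n * s))) / Complex t s \<partial>lborel)"
      unfolding line_integral_def k kernel_tilt[OF t, of n "g n", unfolded Lx]
      by (rule integral_mult_right_zero)
    also have "real n * L t - (real n * x + g n) * t = - real n * rate_function x - g n * t"
      by (simp add: rate_function_eq[OF assms] t_def algebra_simps)
    finally have "complex_of_real (2 * pi * P n) = of_real a * K n / of_real (sqrt (real n))"
      using n by (simp add: a_def K_def)
    hence *: "complex_of_real (2 * pi) * of_real (P n) = of_real a * K n / of_real (sqrt (real n))"
      by (simp only: of_real_mult)
    have "complex_of_real (P n) = complex_of_real (2 * pi) * of_real (P n) / of_real (2 * pi)"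
      by simp
    also have "\<dots> = of_real a * K n / (of_real (sqrt (real n)) * of_real (2 * pi))"
      unfolding * by (simp only: divide_divide_eq_left)
    finally have P: "complex_of_real (P n) = \<dots>" .
    have R: "R n = a / (\<sigma> * t * (sqrt (2 * pi) * sqrt (real n)))"
      by (simp add: R_def a_def real_sqrt_mult)
    have a: "a \<noteq> 0" by (simp add: a_def)
    have q: "complex_of_real (2 * pi) = of_real (sqrt (2 * pi)) * of_real (sqrt (2 * pi))"
      by (simp flip: of_real_mult)
    show ?thesis
      unfolding of_real_divide P R q using a n \<sigma> t by (simp add: divide_simps)
  qed
  have "(\<lambda>n. K n * of_real (\<sigma> * t / sqrt (2 * pi))) \<longlonglongrightarrow>
      of_real (sqrt (2 * pi) / (\<sigma> * t)) * of_real (\<sigma> * t / sqrt (2 * pi))"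
    by (intro tendsto_mult K tendsto_const)
  moreover have "complex_of_real (sqrt (2 * pi) / (\<sigma> * t)) * of_real (\<sigma> * t / sqrt (2 * pi)) = of_real 1"
    unfolding of_real_mult[symmetric] using \<sigma> t by simp
  ultimately have "(\<lambda>n. K n * of_real (\<sigma> * t / sqrt (2 * pi))) \<longlonglongrightarrow> of_real 1" by simp
  hence "(\<lambda>n. complex_of_real (P n / R n)) \<longlonglongrightarrow> of_real 1"
    by (rule Lim_transform_eventually)
       (use eventually_ge_at_top[of 1] in \<open>eventually_elim, simp only: ratio\<close>)
  hence "(\<lambda>n. P n / R n) \<longlonglongrightarrow> 1" by (simp only: tendsto_of_real_iff)
  hence "(\<lambda>n. P n / R n - 1) \<longlonglongrightarrow> 0" by (rule LIM_zero)
  hence "(\<lambda>n. P n / R n - 1) \<in> o[at_top](\<lambda>_. 1)" by (intro smalloI_tendsto) auto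
  moreover have "P n = R n * (1 + (P n / R n - 1))" if "n \<ge> 1" for n
    using that \<sigma> t by (simp add: R_def)
  ultimately show ?thesis
    unfolding P_def R_def g_def sd t_def[symmetric] by blast
qed

end
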